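(* Let $\vartheta$ be a primitive and geometrically compatible random substitution on a finite alphabet $\mathcal A$, with geometric hull $(Y_\vartheta,T)$. Then for every $a\in\mathcal A$ the limit \[ h_a^G=\lim_{m\to\infty}\frac{1}{L(\vartheta^m(a))}\log\big(\#\vartheta^m(a)\big) \] exists and $h_a^G=h_{\mathrm{top}}(Y_\vartheta)$.
   Context: $\mathcal A$ is a finite alphabet, $\mathcal A^+$ the set of non-empty finite words over $\mathcal A$; for $w\in\mathcal A^+$, $|w|$ is its length and $|w|_a$ the number of occurrences of the letter $a$ in $w$. $\mathcal A^{\mathbb Z}$ carries the product topology and the left shift $S$. A random substitution is a map $\vartheta$ from $\mathcal A$ to the non-empty finite subsets of $\mathcal A^+$, extended to words by $\vartheta(u_1\cdots u_n)=\{w_1\cdots w_n: w_i\in\vartheta(u_i)\}$ and to sets of words by taking unions; $\vartheta^n$ is the $n$-fold composition. The language $\mathcal L_\vartheta$ is the set of all subwords of words in $\bigcup_{n\ge1,a\in\mathcal A}\vartheta^n(a)$, and $X_\vartheta=\{x\in\mathcal A^{\mathbb Z}: x_i\cdots x_j\in\mathcal L_\vartheta\text{ for all }i\le j\}$. A marginal of $\vartheta$ is a map $\theta:\mathcal A\to\mathcal A^+$ with $\theta(a)\in\vartheta(a)$ for all $a$; its substitution matrix is $M_{ab}=|\theta(b)|_a$. $\vartheta$ is primitive if for some $n\in\mathbb N$ some marginal of $\vartheta^n$ has a primitive substitution matrix. $\vartheta$ is geometrically compatible if there are $\lambda>1$ and a row vector $L\in(0,\infty)^{\mathcal A}$ that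 is a left eigenvector with eigenvalue $\lambda$ of the substitution matrix of every marginal of $\vartheta$; fix such $L$ and write $L(w)=\sum_{a}L_a|w|_a$ (all words in $\vartheta^m(a)$ have the same geometric length, denoted $L(\vartheta^m(a))=\lambda^mL_a$). The geometric hull $(Y_\vartheta,T)$ is the suspension flow over $(X_\vartheta,S)$ with roof function $x\mapsto L_{x_0}$: $Y_\vartheta=\{(x,s):x\in X_\vartheta,\,0\le s\le L_{x_0}\}$ with $(x,L_{x_0})$ identified with $(Sx,0)$, and $T_t(x,s)=(x,s+t)$. *)

theory Defs
  imports "HOL-Analysis.Analysis"
begin

type_synonym 'a rsubst = "'a \<Rightarrow> 'a list set"

definition random_subst :: "'a rsubst \<Rightarrow> bool" where
  "random_subst \<Theta> \<longleftrightarrow> (\<forall>a. finite (\<Theta> a) \<and> \<Theta> a \<noteq> {} \<and> [] \<notin> \<Theta> a)"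

definition subst_word :: "'a rsubst \<Rightarrow> 'a list \<Rightarrow> 'a list set" where
  "subst_word \<Theta> u = {concat ws | ws. list_all2 (\<lambda>w a. w \<in> \<Theta> a) ws u}"

fun subst_pow :: "'a rsubst \<Rightarrow> nat \<Rightarrow> 'a rsubst" where
  "subst_pow \<Theta> 0 a = {[a]}"
| "subst_pow \<Theta> (Suc n) a = (\<Union>u \<in> subst_pow \<Theta> n a. subst_word \<Theta> u)"

definition language :: "'a rsubst \<Rightarrow> 'a list set" where
  "language \<Theta> = {w. w \<noteq> [] \<and> (\<exists>n\<ge>1. \<exists>a. \<exists>v \<in> subst_pow \<Theta> n a. \<exists>u1 u2. v = u1 @ w @ u2)}"

definition subshift :: "'a rsubst \<Rightarrow> (int \<Rightarrow> 'a) set" where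
  "subshift \<Theta> = {x. \<forall>i j. i \<le> j \<longrightarrow> map x [i..j] \<in> language \<Theta>}"

definition shift :: "(int \<Rightarrow> 'a) \<Rightarrow> (int \<Rightarrow> 'a)" where
  "shift x = (\<lambda>i. x (i + 1))"

definition marginal_of :: "'a rsubst \<Rightarrow> ('a \<Rightarrow> 'a list) \<Rightarrow> bool" where
  "marginal_of \<Theta> \<theta> \<longleftrightarrow> (\<forall>a. \<theta> a \<in> \<Theta> a)"

definition subst_matrix :: "('a \<Rightarrow> 'a list) \<Rightarrow> 'a \<Rightarrow> 'a \<Rightarrow> nat" where
  "subst_matrix \<theta> a b = count_list (\<theta> b) a"

fun mat_pow :: "('a::finite \<Rightarrow> 'a \<Rightarrow> nat) \<Rightarrow> nat \<Rightarrow> 'a \<Rightarrow> 'a \<Rightarrow> nat" where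
  "mat_pow M 0 = (\<lambda>a b. if a = b then 1 else 0)"
| "mat_pow M (Suc k) = (\<lambda>a b. \<Sum>c\<in>UNIV. M a c * mat_pow M k c b)"

definition primitive_matrix :: "('a::finite \<Rightarrow> 'a \<Rightarrow> nat) \<Rightarrow> bool" where
  "primitive_matrix M \<longleftrightarrow> (\<exists>k\<ge>1. \<forall>a b. mat_pow M k a b > 0)"

definition primitive_rsubst :: "('a::finite) rsubst \<Rightarrow> bool" where
  "primitive_rsubst \<Theta> \<longleftrightarrow>
     (\<exists>n\<ge>1. \<exists>\<theta>. marginal_of (subst_pow \<Theta> n) \<theta> \<and> primitive_matrix (subst_matrix \<theta>))"

definition geom_compatible_data :: "('a::finite) rsubst \<Rightarrow> real \<Rightarrow> ('a \<Rightarrow> real) \<Rightarrow> bool" where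
  "geom_compatible_data \<Theta> lam L \<longleftrightarrow> lam > 1 \<and> (\<forall>a. L a > 0) \<and>
     (\<forall>\<theta>. marginal_of \<Theta> \<theta> \<longrightarrow>
        (\<forall>b. (\<Sum>a\<in>UNIV. L a * real (subst_matrix \<theta> a b)) = lam * L b))"

definition X_top :: "'a rsubst \<Rightarrow> (int \<Rightarrow> 'a) topology" where
  "X_top \<Theta> = subtopology (product_topology (\<lambda>_. discrete_topology UNIV) UNIV) (subshift \<Theta>)"

definition susp_domain :: "'a rsubst \<Rightarrow> ('a \<Rightarrow> real) \<Rightarrow> ((int \<Rightarrow> 'a) \<times> real) set" where
  "susp_domain \<Theta> L = {(x, s). x \<in> subshift \<Theta> \<and> 0 \<le> s \<and> s \<le> L (x 0)}"

definition susp_domain_top :: "'a rsubst \<Rightarrow> ('a \<Rightarrow> real) \<Rightarrow> ((int \<Rightarrow> 'a) \<times> real) topology" where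
  "susp_domain_top \<Theta> L = subtopology (prod_topology (X_top \<Theta>) euclideanreal) (susp_domain \<Theta> L)"

text \<open>Canonical representatives of the points of Y_theta: (x,s) with 0 <= s < L_{x_0};
  the identification (x, L_{x_0}) = (Sx, 0) is implemented by the map susp_quot.\<close>
definition susp_reps :: "'a rsubst \<Rightarrow> ('a \<Rightarrow> real) \<Rightarrow> ((int \<Rightarrow> 'a) \<times> real) set" where
  "susp_reps \<Theta> L = {(x, s). x \<in> subshift \<Theta> \<and> 0 \<le> s \<and> s < L (x 0)}"

definition susp_quot :: "('a \<Rightarrow> real) \<Rightarrow> (int \<Rightarrow> 'a) \<times> real \<Rightarrow> (int \<Rightarrow> 'a) \<times> real" where
  "susp_quot L p = (if snd p = L (fst p 0) then (shift (fst p), 0) else p)"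

definition Y_top :: "'a rsubst \<Rightarrow> ('a \<Rightarrow> real) \<Rightarrow> ((int \<Rightarrow> 'a) \<times> real) topology" where
  "Y_top \<Theta> L = topology (\<lambda>U. U \<subseteq> susp_reps \<Theta> L \<and>
      openin (susp_domain_top \<Theta> L) {p \<in> susp_domain \<Theta> L. susp_quot L p \<in> U})"

definition roof_sum :: "('a \<Rightarrow> real) \<Rightarrow> int \<Rightarrow> (int \<Rightarrow> 'a) \<Rightarrow> real" where
  "roof_sum L n x = (if n \<ge> 0 then (\<Sum>i\<in>{0..<n}. L (x i)) else - (\<Sum>i\<in>{n..<0}. L (x i)))"

text \<open>The flow T_t(x,s) = (x, s+t), read in the canonical representatives.\<close>
definition susp_flow :: "'a rsubst \<Rightarrow> ('a \<Rightarrow> real) \<Rightarrow> real \<Rightarrow>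
    (int \<Rightarrow> 'a) \<times> real \<Rightarrow> (int \<Rightarrow> 'a) \<times> real" where
  "susp_flow \<Theta> L t p = (THE q. q \<in> susp_reps \<Theta> L \<and>
      (\<exists>n::int. fst q = (\<lambda>i. fst p (i + n)) \<and> snd q = snd p + t - roof_sum L n (fst p)))"

definition open_cover :: "'b topology \<Rightarrow> 'b set set \<Rightarrow> bool" where
  "open_cover Y U \<longleftrightarrow> (\<forall>A\<in>U. openin Y A) \<and> \<Union>U = topspace Y"

definition min_subcover :: "'b topology \<Rightarrow> 'b set set \<Rightarrow> nat" where
  "min_subcover Y U = (LEAST k. \<exists>V. V \<subseteq> U \<and> finite V \<and> \<Union>V = topspace Y \<and> card V = k)"

definition join_cover :: "'b topology \<Rightarrow> ('b \<Rightarrow> 'b) \<Rightarrow> nat \<Rightarrow> 'b set set \<Rightarrow> 'b set set" where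
  "join_cover Y f n U = {topspace Y \<inter> (\<Inter>i<n. {y \<in> topspace Y. (f ^^ i) y \<in> A i}) | A. \<forall>i<n. A i \<in> U}"

definition cover_entropy :: "'b topology \<Rightarrow> ('b \<Rightarrow> 'b) \<Rightarrow> 'b set set \<Rightarrow> real" where
  "cover_entropy Y f U = lim (\<lambda>n. ln (real (min_subcover Y (join_cover Y f (Suc n) U))) / real (Suc n))"

definition top_entropy :: "'b topology \<Rightarrow> ('b \<Rightarrow> 'b) \<Rightarrow> ereal" where
  "top_entropy Y f = (SUP U \<in> {U. open_cover Y U}. ereal (cover_entropy Y f U))"

definition hull_entropy :: "'a rsubst \<Rightarrow> ('a \<Rightarrow> real) \<Rightarrow> ereal" where
  "hull_entropy \<Theta> L = top_entropy (Y_top \<Theta> L) (susp_flow \<Theta> L 1)"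

end

theory Submission
  imports Defs "HOL-Library.Sublist" "HOL-Real_Asymp.Real_Asymp"
begin

text \<open>
  All words in \<open>\<vartheta>\<^sup>m(a)\<close> have geometric length \<open>\<lambda>\<^sup>m L\<^sub>a\<close>, so a concatenation of images determines
  its factors and \<open>#\<vartheta>\<^sup>m(u)\<close> is the product of the \<open>#\<vartheta>\<^sup>m(u\<^sub>i)\<close>. Hence, for \<open>w \<in> \<vartheta>\<^sup>k(a)\<close>, the rate
  \<open>g\<^sub>m(a) = ln #\<vartheta>\<^sup>m(a) / (\<lambda>\<^sup>m L\<^sub>a)\<close> at level \<open>k + m\<close> dominates a weighted average over the letters
  of \<open>w\<close> of the rates at level \<open>m\<close>. The minimum over the letters is therefore nondecreasing, and by
  primitivity the maximum is squeezed to the same limit \<open>h\<close>.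

  The hull is the quotient of the strip \<open>X \<times> \<real>\<close> by the \<open>\<int>\<close>-action that moves the origin of a tiling
  to another tile, and the flow lifts to the translation of the second coordinate.

  Upper bound: by a Lebesgue number argument, the \<open>n\<close>-fold join of an open cover has a subcover whose
  size is, up to a constant factor, the number of legal words of geometric length at most
  \<open>n + const\<close>. Each such word sits inside an element of \<open>\<vartheta>\<^sup>m(u)\<close> with
  \<open>L(u) \<le> n / \<lambda>\<^sup>m + const\<close>, which bounds the exponential rate by
  \<open>max\<^sub>a g\<^sub>m(a) + const / \<lambda>\<^sup>m\<close> for every \<open>m\<close>.

  Lower bound: for a cover by sufficiently fine patches, the itinerary of \<open>(x, 0)\<close> over time \<open>n\<close>
  determines the tiles of \<open>x\<close> in \<open>[0, n]\<close>; so points carrying different words of \<open>\<vartheta>\<^sup>m(a)\<close> at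
  the origin lie in different elements of the join as soon as \<open>n \<ge> \<lambda>\<^sup>m L\<^sub>a\<close>.
\<close>

section \<open>Growth of real sequences\<close>

lemma subadditive_le_linear:
  fixes a :: "nat \<Rightarrow> real"
  assumes subadd: "\<And>m n. a (m + n) \<le> a m + a n" and "k > 0"
  shows "\<exists>c. \<forall>n. a n \<le> real n * (a k / real k) + c"
proof -
  have multiple: "a (q * k + r) \<le> real q * a k + a r" for q r
  proof (induction q)
    case (Suc q)
    then show ?case
      using subadd[of k "q * k + r"] by (simp add: algebra_simps)
  qed simp
  define c where "c = Max ((\<lambda>r. a r - real r * (a k / real k)) ` {..<k})"
  have remainder: "a r - real r * (a k / real k) \<le> c" if "r < k" for r
    unfolding c_def using that by (intro Max_ge) auto
  have "a n \<le> real n * (a k / real k) + c" for n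
  proof -
    define q r where "q = n div k" and "r = n mod k"
    have n: "n = q * k + r" and "r < k"
      using \<open>k > 0\<close> by (simp_all add: q_def r_def)
    have "a n \<le> real q * a k + a r"
      unfolding n by (rule multiple)
    also have "\<dots> = real n * (a k / real k) + (a r - real r * (a k / real k))"
      using \<open>k > 0\<close> by (simp add: n field_simps)
    finally show ?thesis
      using remainder[OF \<open>r < k\<close>] by linarith
  qed
  then show ?thesis
    by blast
qed

lemma fekete:
  fixes a :: "nat \<Rightarrow> real"
  assumes subadd: "\<And>m n. a (m + n) \<le> a m + a n"
    and bdd: "bdd_below (range (\<lambda>n. a (Suc n) / real (Suc n)))"
  shows "(\<lambda>n. a (Suc n) / real (Suc n)) \<longlonglongrightarrow> (INF n. a (Suc n) / real (Suc n))"
    (is "?r \<longlonglongrightarrow> ?l")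
proof (rule order_tendstoI)
  fix y assume "y < ?l"
  then show "\<forall>\<^sub>F n in sequentially. y < ?r n"
    by (intro always_eventually allI less_le_trans[OF _ cINF_lower[OF bdd]]) auto
next
  fix y assume "?l < y"
  then obtain j where j: "?r j < y"
    using cINF_less_iff[OF _ bdd] by auto
  obtain c where c: "\<And>n. a n \<le> real n * ?r j + c"
    using subadditive_le_linear[OF subadd, of "Suc j"] by auto
  have "?r n \<le> ?r j + c / real (Suc n)" for n
    using divide_right_mono[OF c, of "real (Suc n)" "Suc n"]
    by (simp add: add_divide_distrib del: of_nat_Suc)
  moreover have "(\<lambda>n. ?r j + c / real (Suc n)) \<longlonglongrightarrow> ?r j"
    by real_asymp
  then have "\<forall>\<^sub>F n in sequentially. ?r j + c / real (Suc n) < y"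
    using j by (rule order_tendstoD)
  ultimately show "\<forall>\<^sub>F n in sequentially. ?r n < y"
    by (auto elim!: eventually_mono intro: le_less_trans)
qed

lemma affine_plus_ln_over_n_tendsto:
  fixes h e l c d :: real
  assumes "c > 0" "e > 0"
  shows "(\<lambda>n. (h * (real n + e) + l * ln ((real n + e) / c + 1) + d) / real n) \<longlonglongrightarrow> h"
proof -
  have "(\<lambda>n. (real n + e) / real n) \<longlonglongrightarrow> 1"
    by real_asymp
  moreover have "(\<lambda>n. ln ((real n + e) / c + 1) / real n) \<longlonglongrightarrow> 0"
    using assms by real_asymp
  moreover have "(\<lambda>n. d / real n) \<longlonglongrightarrow> 0"
    by real_asymp
  ultimately have "(\<lambda>n. h * ((real n + e) / real n) + l * (ln ((real n + e) / c + 1) / real n)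
      + d / real n) \<longlonglongrightarrow> h * 1 + l * 0 + 0"
    by (intro tendsto_intros)
  moreover have "h * ((x + e) / x) + l * (y / x) + d / x = (h * (x + e) + l * y + d) / x" for x y
    by (cases "x = 0") (simp_all add: field_simps)
  ultimately show ?thesis
    by simp
qed

section \<open>Open covers and their entropy\<close>

lemma lebesgue_number_basis:
  fixes B :: "nat \<Rightarrow> 'b \<Rightarrow> 'b set"
  assumes "compactin T K" and opens: "\<And>U. U \<in> \<U> \<Longrightarrow> openin T U" and cover: "K \<subseteq> \<Union>\<U>"
    and openin_B: "\<And>n x. openin T (B n x)" and centre: "\<And>n x. x \<in> K \<Longrightarrow> x \<in> B n x"
    and basis: "\<And>U x. openin T U \<Longrightarrow> x \<in> U \<Longrightarrow> \<exists>n. B n x \<subseteq> U"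
    and antimono: "\<And>m n x. m \<le> n \<Longrightarrow> B n x \<subseteq> B m x"
    and triangle: "\<And>n x y z. y \<in> B (Suc n) x \<Longrightarrow> z \<in> B (Suc n) y \<Longrightarrow> z \<in> B n x"
  shows "\<exists>n. \<forall>x\<in>K. \<exists>U\<in>\<U>. B n x \<subseteq> U"
proof -
  have "\<exists>n. \<exists>U\<in>\<U>. B n x \<subseteq> U" if x: "x \<in> K" for x
  proof -
    obtain U where "U \<in> \<U>" "x \<in> U"
      using cover x by blast
    with basis[OF opens] show ?thesis
      by blast
  qed
  then obtain n where n: "\<And>x. x \<in> K \<Longrightarrow> \<exists>U\<in>\<U>. B (n x) x \<subseteq> U"
    by metis
  let ?B = "\<lambda>x. B (Suc (n x)) x"
  have "\<exists>\<F>. finite \<F> \<and> \<F> \<subseteq> ?B ` K \<and> K \<subseteq> \<Union>\<F>"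
    using assms(1) openin_B centre by (intro compactinD) auto
  then obtain \<F> where \<F>: "finite \<F>" "\<F> \<subseteq> ?B ` K" "K \<subseteq> \<Union>\<F>"
    by blast
  obtain F where F: "F \<subseteq> K" "finite F" "\<F> = ?B ` F"
    using finite_subset_image[OF \<F>(1,2)] by blast
  define N where "N = Max (insert 0 ((\<lambda>x. Suc (n x)) ` F))"
  have "\<exists>U\<in>\<U>. B N y \<subseteq> U" if y: "y \<in> K" for y
  proof -
    obtain x where x: "x \<in> F" "y \<in> B (Suc (n x)) x"
      using \<F>(3) F(3) y by blast
    have "Suc (n x) \<le> N"
      unfolding N_def using F(2) x(1) by (intro Max_ge) auto
    then have "B N y \<subseteq> B (n x) x"
      using antimono triangle[OF x(2)] by blast
    then show ?thesis
      using n[of x] x(1) F(1) by blast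
  qed
  then show ?thesis
    by blast
qed

definition has_finite_subcover :: "'b topology \<Rightarrow> 'b set set \<Rightarrow> bool" where
  "has_finite_subcover Y U \<longleftrightarrow> (\<exists>V. V \<subseteq> U \<and> finite V \<and> \<Union>V = topspace Y)"

lemma has_finite_subcoverE:
  assumes "has_finite_subcover Y U"
  obtains V where "V \<subseteq> U" "finite V" "\<Union>V = topspace Y" "card V = min_subcover Y U"
proof -
  have "\<exists>k. \<exists>V. V \<subseteq> U \<and> finite V \<and> \<Union>V = topspace Y \<and> card V = k"
    using assms by (auto simp: has_finite_subcover_def)
  from LeastI_ex[OF this] show thesis
    using that by (auto simp: min_subcover_def)
qed

lemma min_subcover_le:
  assumes "V \<subseteq> U" "finite V" "\<Union>V = topspace Y"
  shows "min_subcover Y U \<le> card V"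
  unfolding min_subcover_def by (rule Least_le) (use assms in blast)

lemma compact_space_imp_has_finite_subcover:
  assumes "compact_space Y" "open_cover Y U"
  shows "has_finite_subcover Y U"
proof -
  have U: "\<And>A. A \<in> U \<Longrightarrow> openin Y A" "topspace Y \<subseteq> \<Union>U"
    using assms(2) by (auto simp: open_cover_def)
  then obtain V where "finite V" "V \<subseteq> U" "topspace Y \<subseteq> \<Union>V"
    using assms(1) unfolding compact_space_alt by meson
  moreover have "\<Union>V \<subseteq> topspace Y"
    using calculation U(1) openin_subset by blast
  ultimately show ?thesis
    unfolding has_finite_subcover_def by blast
qed

lemma min_subcover_pos:
  assumes "has_finite_subcover Y U" "topspace Y \<noteq> {}"
  shows "min_subcover Y U > 0"
proof -
  obtain V where "V \<subseteq> U" "finite V" "\<Union>V = topspace Y" "card V = min_subcover Y U"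
    using assms(1) by (rule has_finite_subcoverE)
  then show ?thesis
    using assms(2) by (metis card_gt_0_iff Union_empty)
qed

lemma min_subcover_le_card_codes:
  assumes "finite F" and code: "\<phi> ` topspace Y \<subseteq> F" and sub: "\<And>A. A \<in> U \<Longrightarrow> A \<subseteq> topspace Y"
    and cell: "\<And>y. y \<in> topspace Y \<Longrightarrow> \<exists>A\<in>U. \<forall>z\<in>topspace Y. \<phi> z = \<phi> y \<longrightarrow> z \<in> A"
  shows "min_subcover Y U \<le> card F"
proof -
  let ?C = "\<phi> ` topspace Y"
  have "\<exists>A\<in>U. {z \<in> topspace Y. \<phi> z = c} \<subseteq> A" if c: "c \<in> ?C" for c
  proof -
    obtain y where "y \<in> topspace Y" "c = \<phi> y"
      using c by blast
    then show ?thesis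
      using cell[of y] by auto
  qed
  then obtain A where A: "\<And>c. c \<in> ?C \<Longrightarrow> A c \<in> U" "\<And>c. c \<in> ?C \<Longrightarrow> {z \<in> topspace Y. \<phi> z = c} \<subseteq> A c"
    by metis
  have "finite ?C"
    using finite_subset[OF code \<open>finite F\<close>] .
  have "\<Union>(A ` ?C) = topspace Y"
    using A sub by blast
  then have "min_subcover Y U \<le> card (A ` ?C)"
    using A(1) \<open>finite ?C\<close> by (intro min_subcover_le) auto
  also have "\<dots> \<le> card ?C"
    using \<open>finite ?C\<close> by (rule card_image_le)
  also have "\<dots> \<le> card F"
    by (rule card_mono[OF \<open>finite F\<close> code])
  finally show ?thesis .
qed

lemma card_separated_le_min_subcover:
  assumes "has_finite_subcover Y U" and range: "f ` S \<subseteq> topspace Y"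
    and separated: "\<And>A v w. A \<in> U \<Longrightarrow> v \<in> S \<Longrightarrow> w \<in> S \<Longrightarrow> f v \<in> A \<Longrightarrow> f w \<in> A \<Longrightarrow> v = w"
  shows "card S \<le> min_subcover Y U"
proof -
  obtain V where V: "V \<subseteq> U" "finite V" "\<Union>V = topspace Y" "card V = min_subcover Y U"
    using assms(1) by (rule has_finite_subcoverE)
  have "\<forall>v\<in>S. \<exists>A\<in>V. f v \<in> A"
    using V(3) range by blast
  then obtain A where A: "\<And>v. v \<in> S \<Longrightarrow> A v \<in> V" "\<And>v. v \<in> S \<Longrightarrow> f v \<in> A v"
    by metis
  have "inj_on A S"
  proof (rule inj_onI)
    fix v w assume "v \<in> S" "w \<in> S" "A v = A w"
    then show "v = w"
      using separated[of "A v" v w] A V(1) by (metis subsetD)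
  qed
  then have "card S \<le> card V"
    by (rule card_inj_on_le) (use A V in auto)
  then show ?thesis
    by (simp add: V)
qed

lemma mem_join_cover_iff:
  "J \<in> join_cover Y f n U \<longleftrightarrow>
    (\<exists>A. J = {y \<in> topspace Y. \<forall>i<n. (f ^^ i) y \<in> A i} \<and> (\<forall>i<n. A i \<in> U))"
proof -
  have "topspace Y \<inter> (\<Inter>i<n. {y \<in> topspace Y. (f ^^ i) y \<in> A i})
      = {y \<in> topspace Y. \<forall>i<n. (f ^^ i) y \<in> A i}" for A
    by auto
  then show ?thesis
    unfolding join_cover_def by simp
qed

locale cover_system =
  fixes Y :: "'b topology" and f :: "'b \<Rightarrow> 'b" and U :: "'b set set"
  assumes maps: "y \<in> topspace Y \<Longrightarrow> f y \<in> topspace Y"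
    and nonempty: "topspace Y \<noteq> {}"
    and finite_subcover: "has_finite_subcover Y U"
begin

abbreviation join_number :: "nat \<Rightarrow> nat" where
  "join_number n \<equiv> min_subcover Y (join_cover Y f n U)"

lemma funpow_maps: "y \<in> topspace Y \<Longrightarrow> (f ^^ i) y \<in> topspace Y"
  by (induction i) (auto intro: maps)

lemma join_cover_Int_vimage:
  assumes "A \<in> join_cover Y f m U" "B \<in> join_cover Y f n U"
  shows "A \<inter> {y \<in> topspace Y. (f ^^ m) y \<in> B} \<in> join_cover Y f (m + n) U"
proof -
  obtain A' B' where A: "A = {y \<in> topspace Y. \<forall>i<m. (f ^^ i) y \<in> A' i}" "\<forall>i<m. A' i \<in> U"
    and B: "B = {y \<in> topspace Y. \<forall>i<n. (f ^^ i) y \<in> B' i}" "\<forall>i<n. B' i \<in> U"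
    using assms unfolding mem_join_cover_iff by (elim exE conjE)
  define C where "C i = (if i < m then A' i else B' (i - m))" for i
  have split: "(\<forall>i<m + n. P i (C i)) \<longleftrightarrow> (\<forall>i<m. P i (A' i)) \<and> (\<forall>i<n. P (i + m) (B' i))" for P
  proof (intro iffI conjI allI impI)
    fix i assume all: "\<forall>i<m + n. P i (C i)"
    show "P i (A' i)" if "i < m"
      using all[rule_format, of i] that by (simp add: C_def)
    show "P (i + m) (B' i)" if "i < n"
      using all[rule_format, of "i + m"] that by (simp add: C_def)
  next
    fix i assume parts: "(\<forall>i<m. P i (A' i)) \<and> (\<forall>i<n. P (i + m) (B' i))" and "i < m + n"
    then show "P i (C i)"
      using conjunct2[OF parts, rule_format, of "i - m"] by (cases "i < m") (auto simp: C_def)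
  qed
  have "A \<inter> {y \<in> topspace Y. (f ^^ m) y \<in> B} = {y \<in> topspace Y. \<forall>i<m + n. (f ^^ i) y \<in> C i}"
    unfolding A(1) B(1) split[of "\<lambda>i D. (f ^^ i) y \<in> D" for y] using funpow_maps
    by (auto simp: funpow_add)
  moreover have "\<forall>i<m + n. C i \<in> U"
    unfolding split[of "\<lambda>i D. D \<in> U"] using A(2) B(2) by blast
  ultimately show ?thesis
    unfolding mem_join_cover_iff by blast
qed

lemma join_subcover_product:
  assumes "V \<subseteq> join_cover Y f m U" "finite V" "\<Union>V = topspace Y"
    and "W \<subseteq> join_cover Y f n U" "finite W" "\<Union>W = topspace Y"
  obtains Z where "Z \<subseteq> join_cover Y f (m + n) U" "finite Z" "\<Union>Z = topspace Y"
    "card Z \<le> card V * card W"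
proof
  define J where "J = (\<lambda>(A, B). A \<inter> {y \<in> topspace Y. (f ^^ m) y \<in> B})"
  let ?Z = "J ` (V \<times> W)"
  show "?Z \<subseteq> join_cover Y f (m + n) U"
    using assms(1,4) by (auto simp: J_def intro!: join_cover_Int_vimage)
  show "finite ?Z"
    using assms(2,5) by simp
  show "\<Union>?Z = topspace Y"
  proof (intro equalityI subsetI)
    fix y assume y: "y \<in> topspace Y"
    then obtain A B where "A \<in> V" "y \<in> A" "B \<in> W" "(f ^^ m) y \<in> B"
      using assms(3,6) funpow_maps[OF y, of m] by blast
    with y show "y \<in> \<Union>?Z"
      by (auto simp: J_def)
  qed (auto simp: J_def)
  show "card ?Z \<le> card V * card W"
    using card_image_le[of "V \<times> W" J] assms(2,5) by (simp add: card_cartesian_product)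
qed

lemma has_finite_subcover_join: "has_finite_subcover Y (join_cover Y f n U)"
proof (induction n)
  case 0
  have "join_cover Y f 0 U = {topspace Y}"
    by (auto simp: join_cover_def)
  then show ?case
    by (auto simp: has_finite_subcover_def)
next
  case (Suc n)
  obtain V where V: "V \<subseteq> join_cover Y f n U" "finite V" "\<Union>V = topspace Y"
    using Suc by (auto simp: has_finite_subcover_def)
  obtain W where W: "W \<subseteq> U" "finite W" "\<Union>W = topspace Y"
    using finite_subcover by (auto simp: has_finite_subcover_def)
  have "W \<subseteq> join_cover Y f 1 U"
  proof
    fix A assume "A \<in> W"
    then have "A = {y \<in> topspace Y. \<forall>i<1. (f ^^ i) y \<in> A}" "A \<in> U"
      using W by auto
    then show "A \<in> join_cover Y f 1 U"
      unfolding mem_join_cover_iff by (intro exI[of _ "\<lambda>_. A"]) simp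
  qed
  from join_subcover_product[OF V this W(2,3)]
  obtain Z where "Z \<subseteq> join_cover Y f (n + 1) U" "finite Z" "\<Union>Z = topspace Y" .
  then show ?case
    unfolding has_finite_subcover_def by auto
qed

lemma join_number_pos: "join_number n > 0"
  by (rule min_subcover_pos[OF has_finite_subcover_join nonempty])

lemma join_number_submult: "join_number (m + n) \<le> join_number m * join_number n"
proof -
  obtain V where V: "V \<subseteq> join_cover Y f m U" "finite V" "\<Union>V = topspace Y" "card V = join_number m"
    using has_finite_subcover_join by (rule has_finite_subcoverE)
  obtain W where W: "W \<subseteq> join_cover Y f n U" "finite W" "\<Union>W = topspace Y" "card W = join_number n"
    using has_finite_subcover_join by (rule has_finite_subcoverE)
  obtain Z where "Z \<subseteq> join_cover Y f (m + n) U" "finite Z" "\<Union>Z = topspace Y"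
    "card Z \<le> card V * card W"
    using join_subcover_product[OF V(1-3) W(1-3)] .
  then show ?thesis
    using min_subcover_le[of Z] V(4) W(4) by (metis order_trans)
qed

lemma cover_entropy_tendsto: "(\<lambda>n. ln (real (join_number n)) / real n) \<longlonglongrightarrow> cover_entropy Y f U"
proof -
  define a where "a n = ln (real (join_number n))" for n
  have "a n \<ge> 0" for n
    using join_number_pos[of n] by (simp add: a_def)
  then have "bdd_below (range (\<lambda>n. a (Suc n) / real (Suc n)))"
    by (intro bdd_belowI[of _ 0]) auto
  moreover have "a (m + n) \<le> a m + a n" for m n
  proof -
    have "a (m + n) \<le> ln (real (join_number m) * real (join_number n))"
      unfolding a_def using join_number_submult[of m n] join_number_pos[of "m + n"]
      by (intro ln_mono) (simp_all flip: of_nat_mult)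
    also have "\<dots> = a m + a n"
      using join_number_pos by (simp add: a_def ln_mult)
    finally show ?thesis .
  qed
  ultimately have "(\<lambda>n. a (Suc n) / real (Suc n)) \<longlonglongrightarrow> (INF n. a (Suc n) / real (Suc n))"
    by (intro fekete)
  then have "(\<lambda>n. a (Suc n) / real (Suc n)) \<longlonglongrightarrow> cover_entropy Y f U"
    unfolding cover_entropy_def a_def by (simp add: limI)
  then show ?thesis
    unfolding a_def by (rule LIMSEQ_imp_Suc)
qed

lemma cover_entropy_leI:
  assumes "\<And>n. ln (real (join_number n)) \<le> b n" "(\<lambda>n. b n / real n) \<longlonglongrightarrow> h"
  shows "cover_entropy Y f U \<le> h"
  using assms
  by (intro LIMSEQ_le[OF cover_entropy_tendsto]) (auto intro!: exI[of _ 0] divide_right_mono)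

lemma cover_entropy_geI:
  assumes t: "filterlim t at_top sequentially" and b: "(\<lambda>m. b m / t m) \<longlonglongrightarrow> h"
    and le: "\<And>m n. t m \<le> real n \<Longrightarrow> b m \<le> ln (real (join_number n))"
  shows "h \<le> cover_entropy Y f U"
proof -
  let ?e = "\<lambda>n. ln (real (join_number n)) / real n" and ?n = "\<lambda>x. nat \<lceil>x\<rceil>"
  have "filterlim (\<lambda>m. ?n (t m)) sequentially sequentially"
    by (rule filterlim_compose[OF _ t]) real_asymp
  then have "(\<lambda>m. ?e (?n (t m))) \<longlonglongrightarrow> cover_entropy Y f U"
    by (rule filterlim_compose[OF cover_entropy_tendsto])
  moreover have "(\<lambda>m. real (?n (t m)) / t m) \<longlonglongrightarrow> 1"
    by (rule filterlim_compose[OF _ t]) real_asymp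
  ultimately have "(\<lambda>m. ?e (?n (t m)) * (real (?n (t m)) / t m)) \<longlonglongrightarrow> cover_entropy Y f U * 1"
    by (rule tendsto_mult)
  moreover have "\<forall>\<^sub>F m in sequentially. b m / t m \<le> ?e (?n (t m)) * (real (?n (t m)) / t m)"
    using filterlim_at_top_dense[THEN iffD1, OF t, rule_format, of 0]
  proof eventually_elim
    case (elim m)
    then have "b m / t m \<le> ln (real (join_number (?n (t m)))) / t m"
      by (intro divide_right_mono le real_nat_ceiling_ge) simp
    moreover have "\<lceil>t m\<rceil> \<noteq> 0"
      using elim by linarith
    ultimately show ?case
      using elim by simp
  qed
  ultimately show ?thesis
    using tendsto_le[OF sequentially_bot _ b] by simp
qed

end

section \<open>Random substitutions acting on words\<close>

lemma subst_word_Nil [simp]: "subst_word \<Theta> [] = {[]}"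
  by (auto simp: subst_word_def)

lemma subst_word_single [simp]: "subst_word \<Theta> [a] = \<Theta> a"
  by (force simp: subst_word_def list_all2_Cons2)

lemma subst_word_append:
  "subst_word \<Theta> (u @ u') = {v @ v' | v v'. v \<in> subst_word \<Theta> u \<and> v' \<in> subst_word \<Theta> u'}"
proof (intro equalityI subsetI)
  fix x assume "x \<in> subst_word \<Theta> (u @ u')"
  then obtain ws ws' where "x = concat ws @ concat ws'"
      "list_all2 (\<lambda>w a. w \<in> \<Theta> a) ws u" "list_all2 (\<lambda>w a. w \<in> \<Theta> a) ws' u'"
    by (auto simp: subst_word_def list_all2_append2)
  then show "x \<in> {v @ v' | v v'. v \<in> subst_word \<Theta> u \<and> v' \<in> subst_word \<Theta> u'}"
    by (auto simp: subst_word_def)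
next
  fix x assume "x \<in> {v @ v' | v v'. v \<in> subst_word \<Theta> u \<and> v' \<in> subst_word \<Theta> u'}"
  then obtain ws ws' where "x = concat (ws @ ws')" "list_all2 (\<lambda>w a. w \<in> \<Theta> a) (ws @ ws') (u @ u')"
    by (auto simp: subst_word_def intro: list_all2_appendI)
  then show "x \<in> subst_word \<Theta> (u @ u')"
    unfolding subst_word_def by blast
qed

lemma subst_word_Cons: "subst_word \<Theta> (a # u) = {v @ v' | v v'. v \<in> \<Theta> a \<and> v' \<in> subst_word \<Theta> u}"
  using subst_word_append[of \<Theta> "[a]" u] by simp

lemma finite_subst_word: "(\<And>a. finite (\<Theta> a)) \<Longrightarrow> finite (subst_word \<Theta> u)"
  by (induction u) (auto simp: subst_word_Cons intro: finite_image_set2)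

lemma subst_word_nonempty: "(\<And>a. \<Theta> a \<noteq> {}) \<Longrightarrow> subst_word \<Theta> u \<noteq> {}"
  by (induction u) (auto simp: subst_word_Cons)

lemma length_subst_word:
  assumes "\<And>a. [] \<notin> \<Theta> a" "v \<in> subst_word \<Theta> u"
  shows "length u \<le> length v"
  using assms(2)
proof (induction u arbitrary: v)
  case (Cons a u)
  then obtain y z where "v = y @ z" "y \<in> \<Theta> a" "z \<in> subst_word \<Theta> u"
    by (auto simp: subst_word_Cons)
  moreover from this have "y \<noteq> []" "length u \<le> length z"
    using assms(1)[of a] Cons.IH by auto
  ultimately show ?case
    by (cases y) auto
qed simp

lemma subst_word_comp:
  "subst_word (\<lambda>a. \<Union>v\<in>\<Phi> a. subst_word \<Theta> v) u = (\<Union>v\<in>subst_word \<Phi> u. subst_word \<Theta> v)"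
proof (induction u)
  case (Cons a u)
  have "subst_word (\<lambda>a. \<Union>v\<in>\<Phi> a. subst_word \<Theta> v) (a # u) =
      (\<Union>v\<in>\<Phi> a. \<Union>v'\<in>subst_word \<Phi> u. subst_word \<Theta> (v @ v'))"
    unfolding subst_word_Cons subst_word_append Cons by blast
  also have "\<dots> = (\<Union>v\<in>subst_word \<Phi> (a # u). subst_word \<Theta> v)"
    unfolding subst_word_Cons by blast
  finally show ?case .
qed simp

lemma subst_word_rev: "subst_word (\<lambda>a. rev ` \<Theta> a) (rev u) = rev ` subst_word \<Theta> u"
proof (induction u)
  case (Cons a u)
  have "subst_word (\<lambda>a. rev ` \<Theta> a) (rev (a # u)) =
      {rev v' @ rev v | v v'. v \<in> \<Theta> a \<and> v' \<in> subst_word \<Theta> u}"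
    using Cons by (auto simp: subst_word_append)
  also have "\<dots> = rev ` subst_word \<Theta> (a # u)"
    unfolding subst_word_Cons by (auto simp: image_iff) (metis rev_append)+
  finally show ?case .
qed simp

lemma subst_pow_add:
  "subst_pow \<Theta> (n + m) a = (\<Union>u\<in>subst_pow \<Theta> n a. subst_word (subst_pow \<Theta> m) u)"
proof (induction m arbitrary: a)
  case 0
  have "subst_pow \<Theta> 0 = (\<lambda>a. {[a]})"
    by (rule ext) simp
  moreover have "subst_word (\<lambda>a. {[a]}) u = {u}" for u :: "'a list"
    by (induction u) (auto simp: subst_word_Cons)
  ultimately show ?case
    by simp
next
  case (Suc m)
  have "subst_pow \<Theta> (Suc m) = (\<lambda>a. \<Union>v\<in>subst_pow \<Theta> m a. subst_word \<Theta> v)"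
    by (rule ext) simp
  with Suc show ?case
    by (simp add: subst_word_comp)
qed

lemma subst_pow_addI:
  "u \<in> subst_pow \<Theta> n a \<Longrightarrow> v \<in> subst_word (subst_pow \<Theta> m) u \<Longrightarrow> v \<in> subst_pow \<Theta> (n + m) a"
  by (auto simp: subst_pow_add)

lemma random_substD:
  assumes "random_subst \<Theta>"
  shows "finite (\<Theta> a)" "\<Theta> a \<noteq> {}" "[] \<notin> \<Theta> a"
  using assms by (auto simp: random_subst_def)

lemma subst_word_in_context:
  assumes "random_subst \<Phi>" and v: "v \<in> \<Phi> b"
  obtains v1 v2 where "v1 @ v @ v2 \<in> subst_word \<Phi> (u1 @ b # u2)"
    "length u1 \<le> length v1" "length u2 \<le> length v2"
proof -
  note \<Phi> = random_substD[OF assms(1)]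
  obtain v1 v2 where v12: "v1 \<in> subst_word \<Phi> u1" "v2 \<in> subst_word \<Phi> u2"
    using subst_word_nonempty[of \<Phi>, OF \<Phi>(2)] by (metis ex_in_conv)
  then have "v1 @ v @ v2 \<in> subst_word \<Phi> (u1 @ b # u2)"
    using v unfolding subst_word_append subst_word_Cons by blast
  with v12 that show thesis
    using length_subst_word[of \<Phi>, OF \<Phi>(3)] by blast
qed

lemma random_subst_subst_pow:
  assumes "random_subst \<Theta>"
  shows "random_subst (subst_pow \<Theta> n)"
proof (induction n)
  case 0
  show ?case
    by (simp add: random_subst_def)
next
  case (Suc n)
  have "[] \<notin> subst_word \<Theta> u" if "u \<noteq> []" for u
    using length_subst_word[of \<Theta> "[]" u] random_substD[OF assms] that by auto
  then show ?case
    using random_substD[OF Suc] random_substD[OF assms] subst_word_nonempty[of \<Theta>]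
    unfolding random_subst_def by (auto intro!: finite_subst_word) metis+
qed

lemma mem_language_iff:
  "w \<in> language \<Theta> \<longleftrightarrow> w \<noteq> [] \<and> (\<exists>n\<ge>1. \<exists>a. \<exists>v\<in>subst_pow \<Theta> n a. sublist w v)"
  by (simp add: language_def sublist_def)

lemma language_sublist: "v \<in> language \<Theta> \<Longrightarrow> sublist w v \<Longrightarrow> w \<noteq> [] \<Longrightarrow> w \<in> language \<Theta>"
  unfolding mem_language_iff by (meson sublist_order.order_trans)

section \<open>Primitivity\<close>

definition apply_marginal :: "('a \<Rightarrow> 'a list) \<Rightarrow> 'a list \<Rightarrow> 'a list" where
  "apply_marginal \<theta> u = concat (map \<theta> u)"

lemma set_apply_marginal [simp]: "set (apply_marginal \<theta> u) = (\<Union>a\<in>set u. set (\<theta> a))"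
  by (auto simp: apply_marginal_def)

lemma apply_marginal_mem_subst_word:
  assumes "\<And>a. \<theta> a \<in> \<Phi> a"
  shows "apply_marginal \<theta> u \<in> subst_word \<Phi> u"
  unfolding apply_marginal_def by (induction u) (use assms in \<open>auto simp: subst_word_Cons\<close>)

lemma apply_marginal_funpow_mem_subst_pow:
  assumes "marginal_of (subst_pow \<Theta> n) \<theta>"
  shows "(apply_marginal \<theta> ^^ j) [b] \<in> subst_pow \<Theta> (n * j) b"
proof (induction j)
  case (Suc j)
  have "(apply_marginal \<theta> ^^ Suc j) [b] \<in> subst_pow \<Theta> (n * j + n) b"
    using assms
    by (auto simp: marginal_of_def intro: subst_pow_addI[OF Suc] apply_marginal_mem_subst_word)
  then show ?case
    by (simp add: add.commute)
qed simp

lemma mat_pow_pos_imp_occurs: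
  "mat_pow (subst_matrix \<theta>) j a b > 0 \<Longrightarrow> a \<in> set ((apply_marginal \<theta> ^^ j) [b])"
proof (induction j arbitrary: a)
  case (Suc j)
  then obtain c where "subst_matrix \<theta> a c * mat_pow (subst_matrix \<theta>) j c b > 0"
    by (auto simp: neq0_conv[symmetric] simp del: neq0_conv)
  then have "subst_matrix \<theta> a c > 0" and "c \<in> set ((apply_marginal \<theta> ^^ j) [b])"
    using Suc.IH by auto
  moreover from this have "a \<in> set (\<theta> c)"
    by (metis count_notin less_irrefl subst_matrix_def)
  ultimately show ?case
    by auto
qed (simp split: if_splits)

lemma primitive_imp_full_words:
  fixes \<Theta> :: "('a::finite) rsubst"
  assumes rs: "random_subst \<Theta>" and "primitive_rsubst \<Theta>"
  obtains N where "\<And>p a. p \<ge> N \<Longrightarrow> \<exists>w\<in>subst_pow \<Theta> p a. set w = UNIV"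
proof -
  obtain n \<theta> k where \<theta>: "marginal_of (subst_pow \<Theta> n) \<theta>"
      and k: "\<And>a b. mat_pow (subst_matrix \<theta>) k a b > 0"
    using assms by (auto simp: primitive_rsubst_def primitive_matrix_def)
  define full where "full b = (apply_marginal \<theta> ^^ k) [b]" for b
  have full: "full b \<in> subst_pow \<Theta> (n * k) b" "set (full b) = UNIV" for b
    unfolding full_def
    using apply_marginal_funpow_mem_subst_pow[OF \<theta>] mat_pow_pos_imp_occurs k by blast+
  have "\<exists>w\<in>subst_pow \<Theta> p a. set w = UNIV" if "p \<ge> n * k" for p a
  proof -
    obtain u where u: "u \<in> subst_pow \<Theta> (p - n * k) a" "u \<noteq> []"
      using random_substD[OF random_subst_subst_pow[OF rs]] by (metis all_not_in_conv)
    have "apply_marginal full u \<in> subst_pow \<Theta> (p - n * k + n * k) a"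
      using u(1) apply_marginal_mem_subst_word[OF full(1)] by (rule subst_pow_addI)
    moreover have "set (apply_marginal full u) = UNIV"
      using u(2) full(2) by (cases u) auto
    ultimately show ?thesis
      using that by force
  qed
  with that show thesis
    by blast
qed

section \<open>Geometric length\<close>

lemma sum_count_list:
  fixes f :: "'a::finite \<Rightarrow> real"
  shows "(\<Sum>a\<in>UNIV. f a * real (count_list w a)) = (\<Sum>a\<leftarrow>w. f a)"
proof (induction w)
  case (Cons b w)
  have "(\<Sum>a\<in>UNIV. f a * real (count_list (b # w) a))
      = (\<Sum>a\<in>UNIV. f a * real (count_list w a) + (if a = b then f b else 0))"
    by (intro sum.cong) (auto simp: algebra_simps)
  with Cons show ?case
    by (simp add: sum.distrib)
qed simp

locale letter_lengths =
  fixes L :: "'a::finite \<Rightarrow> real"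
  assumes L_pos [simp]: "L a > 0"
begin

definition Lmin :: real where "Lmin = Min (range L)"
definition Lmax :: real where "Lmax = Max (range L)"

abbreviation geom_length :: "'a list \<Rightarrow> real" where
  "geom_length w \<equiv> (\<Sum>a\<leftarrow>w. L a)"

lemma Lmin_le [simp]: "Lmin \<le> L a" and L_le_Lmax [simp]: "L a \<le> Lmax"
  by (simp_all add: Lmin_def Lmax_def)

lemma L_nonneg [simp]: "L a \<ge> 0" and L_nonzero [simp]: "L a \<noteq> 0"
  using L_pos[of a] by linarith+

lemma Lmin_pos [simp]: "Lmin > 0"
  by (simp add: Lmin_def)

lemma Lmax_pos [simp]: "Lmax > 0"
  using less_le_trans[OF L_pos L_le_Lmax] .

lemma Lmin_Lmax_nonneg [simp]: "Lmin \<ge> 0" "Lmax \<ge> 0"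
  using Lmin_pos Lmax_pos by linarith+

lemma geom_length_nonneg [simp]: "geom_length w \<ge> 0"
  by (intro sum_list_nonneg) auto

lemma geom_length_eq_0_iff [simp]: "geom_length w = 0 \<longleftrightarrow> w = []"
  by (cases w) (auto simp: add_nonneg_eq_0_iff)

lemma geom_length_ge: "Lmin * real (length w) \<le> geom_length w"
  by (induction w) (auto simp: algebra_simps add_mono)

lemma geom_length_le: "geom_length w \<le> Lmax * real (length w)"
  by (induction w) (auto simp: algebra_simps add_mono)

lemma append_eq_geom_length_cancel:
  assumes "v @ w = v' @ w'" "geom_length v = geom_length v'"
  shows "v = v' \<and> w = w'"
proof -
  from assms(1) consider us where "v = v' @ us" "us @ w = w'" | us where "v' = v @ us" "w = us @ w'"
    by (auto simp: append_eq_append_conv2)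
  then show ?thesis
    using assms(2) by cases auto
qed

lemma geom_length_eq_imp_eq:
  assumes "geom_length v = geom_length w"
    and common: "\<And>j. j < length v \<Longrightarrow> j < length w \<Longrightarrow> v ! j = w ! j"
  shows "v = w"
proof -
  define n where "n = min (length v) (length w)"
  have split: "geom_length u = geom_length (take n u) + geom_length (drop n u)" for u
    by (simp flip: sum_list_append map_append)
  have "take n v = take n w"
    using common by (intro nth_equalityI) (auto simp: n_def)
  then have "geom_length (drop n v) = geom_length (drop n w)"
    using assms(1) split[of v] split[of w] by simp
  moreover have "drop n v = [] \<or> drop n w = []"
    by (auto simp: n_def)
  ultimately have "drop n v = drop n w"
    by (metis geom_length_eq_0_iff)
  with \<open>take n v = take n w\<close> show ?thesis
    by (metis append_take_drop_id)
qed

lemma sum_weighted_le: "(\<And>b. h b \<le> c) \<Longrightarrow> (\<Sum>b\<leftarrow>w. L b * h b) \<le> c * geom_length w"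
  unfolding sum_list_const_mult[symmetric]
  by (rule sum_list_mono) (simp add: mult.commute[of c] mult_left_mono)

lemma sum_weighted_ge: "(\<And>b. c \<le> h b) \<Longrightarrow> c * geom_length w \<le> (\<Sum>b\<leftarrow>w. L b * h b)"
  unfolding sum_list_const_mult[symmetric]
  by (rule sum_list_mono) (simp add: mult.commute[of c] mult_left_mono)

lemma sum_weighted_excess_ge:
  assumes "\<And>b. c \<le> h b" and "b \<in> set w"
  shows "c * geom_length w + L b * (h b - c) \<le> (\<Sum>b\<leftarrow>w. L b * h b)"
proof -
  obtain w1 w2 where w: "w = w1 @ b # w2"
    using assms(2) by (auto dest: split_list)
  show ?thesis
    using sum_weighted_ge[of c h w1] sum_weighted_ge[of c h w2] assms(1)
    by (simp add: w algebra_simps)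
qed

lemma card_subst_word:
  assumes "\<And>a v. v \<in> \<Phi> a \<Longrightarrow> geom_length v = c a"
  shows "card (subst_word \<Phi> u) = (\<Prod>a\<leftarrow>u. card (\<Phi> a))"
proof (induction u)
  case (Cons a u)
  have "subst_word \<Phi> (a # u) = (\<lambda>(v, w). v @ w) ` (\<Phi> a \<times> subst_word \<Phi> u)"
    by (force simp: subst_word_Cons)
  moreover have "inj_on (\<lambda>(v, w). v @ w) (\<Phi> a \<times> subst_word \<Phi> u)"
    by (auto simp: inj_on_def assms dest: append_eq_geom_length_cancel)
  ultimately show ?case
    using Cons by (simp add: card_image card_cartesian_product)
qed simp

lemma geom_length_subst_word:
  assumes "\<And>a v. v \<in> \<Phi> a \<Longrightarrow> geom_length v = c * L a" and "v \<in> subst_word \<Phi> u"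
  shows "geom_length v = c * geom_length u"
  using assms(2)
  by (induction u arbitrary: v) (auto simp: subst_word_Cons assms(1) algebra_simps)

lemma subst_word_trim_prefix:
  assumes bound: "\<And>a v. v \<in> \<Phi> a \<Longrightarrow> geom_length v \<le> b" and "b \<ge> 0"
    and "p @ w \<in> subst_word \<Phi> u"
  shows "\<exists>p' u'. p' @ w \<in> subst_word \<Phi> u' \<and> geom_length p' \<le> b"
  using assms(3)
proof (induction u arbitrary: p)
  case (Cons a u)
  obtain v v' where v: "p @ w = v @ v'" "v \<in> \<Phi> a" "v' \<in> subst_word \<Phi> u"
    using Cons.prems by (auto simp: subst_word_Cons)
  from v(1) consider us where "v = p @ us" | us where "v' = us @ w"
    by (auto simp: append_eq_append_conv2)
  then show ?case
  proof cases
    case 1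
    then have "geom_length p \<le> geom_length v"
      by simp
    also have "\<dots> \<le> b"
      using v(2) by (rule bound)
    finally have "geom_length p \<le> b" .
    with Cons.prems show ?thesis
      by blast
  next
    case 2
    with v(3) Cons.IH show ?thesis
      by blast
  qed
qed (use \<open>b \<ge> 0\<close> in \<open>auto intro!: exI[of _ "[]"]\<close>)

lemma subst_word_trim_suffix:
  assumes bound: "\<And>a v. v \<in> \<Phi> a \<Longrightarrow> geom_length v \<le> b" and "b \<ge> 0"
    and "w @ q \<in> subst_word \<Phi> u"
  shows "\<exists>q' u'. w @ q' \<in> subst_word \<Phi> u' \<and> geom_length q' \<le> b"
proof -
  let ?\<Psi> = "\<lambda>a. rev ` \<Phi> a"
  have "rev q @ rev w \<in> subst_word ?\<Psi> (rev u)"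
    using imageI[OF assms(3), of rev] by (simp add: subst_word_rev)
  moreover have "geom_length v \<le> b" if "v \<in> ?\<Psi> a" for a v
    using that bound by (auto simp flip: rev_map)
  ultimately obtain p u' where p: "p @ rev w \<in> subst_word ?\<Psi> (rev (rev u'))" "geom_length p \<le> b"
    using subst_word_trim_prefix[of ?\<Psi> b "rev q" "rev w"] \<open>b \<ge> 0\<close> by (metis rev_rev_ident)
  then have "w @ rev p \<in> subst_word \<Phi> (rev u')"
    unfolding subst_word_rev by (metis imageE rev_append rev_rev_ident)
  moreover have "geom_length (rev p) \<le> b"
    using p(2) by (simp flip: rev_map)
  ultimately show ?thesis
    by blast
qed

lemma subst_word_trim:
  assumes bound: "\<And>a v. v \<in> \<Phi> a \<Longrightarrow> geom_length v \<le> b" and "b \<ge> 0"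
    and "v \<in> subst_word \<Phi> u" "sublist w v"
  obtains v' u' where "v' \<in> subst_word \<Phi> u'" "sublist w v'" "geom_length v' \<le> geom_length w + 2 * b"
proof -
  obtain p q where pq: "p @ w @ q \<in> subst_word \<Phi> u"
    using assms(3,4) by (auto simp: sublist_def)
  obtain p' u1 where p': "p' @ w @ q \<in> subst_word \<Phi> u1" "geom_length p' \<le> b"
    using subst_word_trim_prefix[of \<Phi> b, OF _ \<open>b \<ge> 0\<close> pq] bound by blast
  then have "(p' @ w) @ q \<in> subst_word \<Phi> u1"
    by simp
  then obtain q' u2 where "(p' @ w) @ q' \<in> subst_word \<Phi> u2" "geom_length q' \<le> b"
    using subst_word_trim_suffix[of \<Phi> b, OF _ \<open>b \<ge> 0\<close>] bound by blast
  with p'(2) that[of "p' @ w @ q'" u2] show thesis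
    by simp
qed

definition words_upto :: "real \<Rightarrow> 'a list set" where
  "words_upto r = {u. geom_length u \<le> r}"

lemma mem_words_upto_iff [simp]: "u \<in> words_upto r \<longleftrightarrow> geom_length u \<le> r"
  by (simp add: words_upto_def)

lemma length_le_geom_length: "geom_length u \<le> r \<Longrightarrow> real (length u) \<le> r / Lmin"
  using geom_length_ge[of u] by (simp add: pos_le_divide_eq mult.commute)

lemma words_upto_subset: "words_upto r \<subseteq> {u. set u \<subseteq> UNIV \<and> length u \<le> nat \<lfloor>r / Lmin\<rfloor>}"
  using length_le_geom_length by (auto intro: le_nat_floor)

lemma finite_words_upto [simp]: "finite (words_upto r)"
  by (rule finite_subset[OF words_upto_subset finite_lists_length_le]) simp

definition full_rate :: real where
  "full_rate = ln (real CARD('a) + 1) / Lmin"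

lemma card_words_upto_le:
  assumes "r \<ge> 0"
  shows "real (card (words_upto r)) \<le> exp (full_rate * r)"
proof -
  define n where "n = nat \<lfloor>r / Lmin\<rfloor>"
  have "card (words_upto r) \<le> card {u. set u \<subseteq> (UNIV :: 'a set) \<and> length u \<le> n}"
    unfolding n_def by (intro card_mono words_upto_subset finite_lists_length_le) simp
  also have "\<dots> = (\<Sum>i\<le>n. CARD('a) ^ i)"
    by (rule card_lists_length_le) simp
  also have "\<dots> \<le> (\<Sum>i\<le>n. (n choose i) * CARD('a) ^ i)"
    by (intro sum_mono) (simp add: Suc_le_eq)
  also have "\<dots> = (CARD('a) + 1) ^ n"
    using binomial[of "CARD('a)" 1 n] by simp
  finally have "real (card (words_upto r)) \<le> real ((CARD('a) + 1) ^ n)"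
    by (rule of_nat_mono)
  also have "\<dots> = exp (ln (real CARD('a) + 1) * real n)"
    by (simp add: exp_of_nat2_mult add_pos_nonneg add.commute)
  also have "\<dots> \<le> exp (ln (real CARD('a) + 1) * (r / Lmin))"
  proof -
    have "real n \<le> r / Lmin"
      using assms by (simp add: n_def)
    then show ?thesis
      unfolding exp_le_cancel_iff by (rule mult_left_mono) simp
  qed
  finally show ?thesis
    by (simp add: full_rate_def)
qed

end

section \<open>Growth rates of the letters\<close>

locale geom_rsubst =
  fixes \<Theta> :: "('a::finite) rsubst" and lam :: real and L :: "'a \<Rightarrow> real"
  assumes random: "random_subst \<Theta>"
    and geom_compatible: "geom_compatible_data \<Theta> lam L"

sublocale geom_rsubst \<subseteq> letter_lengths L
  using geom_compatible by unfold_locales (simp add: geom_compatible_data_def)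

context geom_rsubst
begin

lemma lam_gt_1: "lam > 1"
  using geom_compatible by (simp add: geom_compatible_data_def)

lemma lam_pos [simp]: "lam > 0" and lam_nonneg [simp]: "lam \<ge> 0" and lam_nonzero [simp]: "lam \<noteq> 0"
  using lam_gt_1 by simp_all

lemma random_subst_pow: "random_subst (subst_pow \<Theta> m)"
  using random by (rule random_subst_subst_pow)

lemma finite_subst_pow [simp]: "finite (subst_pow \<Theta> m a)"
  and subst_pow_nonempty [simp]: "subst_pow \<Theta> m a \<noteq> {}"
  and Nil_notin_subst_pow [simp]: "[] \<notin> subst_pow \<Theta> m a"
  using random_substD[OF random_subst_pow] by auto

lemma finite_subst_word_pow [simp]: "finite (subst_word (subst_pow \<Theta> m) u)"
  and subst_word_pow_nonempty [simp]: "subst_word (subst_pow \<Theta> m) u \<noteq> {}"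
  by (simp_all add: finite_subst_word subst_word_nonempty)

lemma card_subst_pow_pos [simp]: "card (subst_pow \<Theta> m a) > 0"
  by (simp add: card_gt_0_iff)

lemma card_subst_word_pow_pos [simp]: "card (subst_word (subst_pow \<Theta> m) u) > 0"
  by (simp add: card_gt_0_iff)

lemma geom_length_image:
  assumes "w \<in> \<Theta> a"
  shows "geom_length w = lam * L a"
proof -
  have "\<forall>b. \<exists>v. v \<in> \<Theta> b"
    using random_substD(2)[OF random] by blast
  then obtain \<theta> where "\<And>b. \<theta> b \<in> \<Theta> b"
    by metis
  then have "marginal_of \<Theta> (\<theta>(a := w))"
    using assms by (auto simp: marginal_of_def)
  then have "(\<Sum>c\<in>UNIV. L c * real (subst_matrix (\<theta>(a := w)) c a)) = lam * L a"
    using geom_compatible by (auto simp: geom_compatible_data_def)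
  then show ?thesis
    by (simp add: subst_matrix_def sum_count_list)
qed

lemma geom_length_subst_pow: "v \<in> subst_pow \<Theta> m a \<Longrightarrow> geom_length v = lam ^ m * L a"
proof (induction m arbitrary: v)
  case (Suc m)
  then obtain u where "u \<in> subst_pow \<Theta> m a" "v \<in> subst_word \<Theta> u"
    by auto
  with Suc.IH[of u] geom_length_subst_word[OF geom_length_image] show ?case
    by simp
qed simp

lemma geom_length_subst_word_pow:
  "v \<in> subst_word (subst_pow \<Theta> m) u \<Longrightarrow> geom_length v = lam ^ m * geom_length u"
  by (rule geom_length_subst_word[OF geom_length_subst_pow])

definition growth :: "nat \<Rightarrow> 'a \<Rightarrow> real" where
  "growth m a = ln (real (card (subst_pow \<Theta> m a))) / (lam ^ m * L a)"

definition min_growth :: "nat \<Rightarrow> real" where "min_growth m = Min (range (growth m))"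
definition max_growth :: "nat \<Rightarrow> real" where "max_growth m = Max (range (growth m))"

lemma min_growth_le [simp]: "min_growth m \<le> growth m a"
  and growth_le_max_growth [simp]: "growth m a \<le> max_growth m"
  by (simp_all add: min_growth_def max_growth_def)

lemma min_growth_le_max_growth: "min_growth m \<le> max_growth m"
  using order_trans[OF min_growth_le growth_le_max_growth] .

lemma ln_card_subst_pow: "ln (real (card (subst_pow \<Theta> m a))) = lam ^ m * (L a * growth m a)"
  by (simp add: growth_def)

lemma ln_card_subst_word_pow:
  "ln (real (card (subst_word (subst_pow \<Theta> m) u))) = lam ^ m * (\<Sum>b\<leftarrow>u. L b * growth m b)"
proof (induction u)
  case (Cons a u)
  have "card (subst_word (subst_pow \<Theta> m) (a # u))
      = card (subst_pow \<Theta> m a) * card (subst_word (subst_pow \<Theta> m) u)"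
    using card_subst_word[of "subst_pow \<Theta> m", OF geom_length_subst_pow] by simp
  with Cons show ?case
    by (simp add: ln_mult ln_card_subst_pow ring_distribs)
qed simp

lemma sum_growth_le:
  assumes "w \<in> subst_pow \<Theta> k a"
  shows "(\<Sum>b\<leftarrow>w. L b * growth m b) \<le> lam ^ k * L a * growth (k + m) a"
proof -
  have "subst_word (subst_pow \<Theta> m) w \<subseteq> subst_pow \<Theta> (k + m) a"
    using assms by (auto intro: subst_pow_addI)
  then have "card (subst_word (subst_pow \<Theta> m) w) \<le> card (subst_pow \<Theta> (k + m) a)"
    by (simp add: card_mono)
  then have "ln (real (card (subst_word (subst_pow \<Theta> m) w)))
      \<le> ln (real (card (subst_pow \<Theta> (k + m) a)))"
    by simp
  then have "lam ^ m * (\<Sum>b\<leftarrow>w. L b * growth m b) \<le> lam ^ m * (lam ^ k * L a * growth (k + m) a)"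
    unfolding ln_card_subst_word_pow ln_card_subst_pow
    by (simp add: power_add mult.assoc mult.left_commute)
  then show ?thesis
    by simp
qed

lemma min_growth_le_growth_add: "min_growth m \<le> growth (k + m) a"
proof -
  obtain w where w: "w \<in> subst_pow \<Theta> k a"
    using subst_pow_nonempty by blast
  have "min_growth m * (lam ^ k * L a) \<le> growth (k + m) a * (lam ^ k * L a)"
    using order_trans[OF sum_weighted_ge[of "min_growth m" "growth m" w] sum_growth_le[OF w]]
    by (simp add: geom_length_subst_pow[OF w] mult.commute)
  then show ?thesis
    by (rule mult_right_le_imp_le) simp
qed

lemma incseq_min_growth: "incseq min_growth"
proof (rule incseq_SucI)
  fix m
  show "min_growth m \<le> min_growth (Suc m)"
    using min_growth_le_growth_add[of m 1] by (subst (2) min_growth_def) simp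
qed

lemma max_growth_nonneg: "0 \<le> max_growth m"
proof -
  have "0 \<le> growth m a" for a
    unfolding growth_def using card_subst_pow_pos[of m a]
    by (intro divide_nonneg_pos ln_ge_zero) (auto simp: Suc_le_eq simp del: card_subst_pow_pos)
  then show ?thesis
    using order_trans growth_le_max_growth by blast
qed

lemma growth_le_full_rate: "growth m a \<le> full_rate"
proof -
  let ?r = "lam ^ m * L a"
  have "subst_pow \<Theta> m a \<subseteq> words_upto ?r"
    using geom_length_subst_pow by auto
  then have "real (card (subst_pow \<Theta> m a)) \<le> real (card (words_upto ?r))"
    by (simp add: card_mono)
  also have "\<dots> \<le> exp (full_rate * ?r)"
    by (rule card_words_upto_le) simp
  finally have "ln (real (card (subst_pow \<Theta> m a))) \<le> full_rate * ?r"
    by (subst ln_exp[symmetric]) (intro ln_mono, auto)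
  then show ?thesis
    by (simp add: growth_def pos_divide_le_eq)
qed

end

locale primitive_geom_rsubst = geom_rsubst +
  assumes primitive: "primitive_rsubst \<Theta>"
begin

text \<open>By primitivity every letter has a descendant word in which the letter realising
  \<^term>\<open>max_growth m\<close> carries a weight bounded below, so a gap between \<^term>\<open>min_growth\<close> and
  \<^term>\<open>max_growth\<close> forces \<^term>\<open>min_growth\<close> to grow.\<close>

lemma min_growth_increment:
  obtains N c where "c > 0"
    "\<And>m. min_growth m + c * (max_growth m - min_growth m) \<le> min_growth (N + m)"
proof -
  obtain N where N: "\<And>p a. p \<ge> N \<Longrightarrow> \<exists>w\<in>subst_pow \<Theta> p a. set w = UNIV"
    using primitive_imp_full_words[OF random primitive] by blast
  define c where "c = Lmin / (lam ^ N * Lmax)"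
  have "min_growth m + c * (max_growth m - min_growth m) \<le> growth (N + m) a" for m a
  proof -
    let ?gap = "max_growth m - min_growth m" and ?r = "lam ^ N * L a"
    obtain w where w: "w \<in> subst_pow \<Theta> N a" "set w = UNIV"
      using N by blast
    have "max_growth m \<in> range (growth m)"
      unfolding max_growth_def by (rule Max_in) simp_all
    then obtain b where b: "growth m b = max_growth m"
      by auto
    have "c * ?r \<le> Lmin"
      by (simp add: c_def field_simps)
    then have "c * ?r \<le> L b"
      using Lmin_le[of b] by linarith
    then have "(c * ?r) * ?gap \<le> L b * ?gap"
      using min_growth_le_max_growth[of m] by (intro mult_right_mono) auto
    moreover have "min_growth m * ?r + L b * ?gap \<le> (\<Sum>b\<leftarrow>w. L b * growth m b)"
      using sum_weighted_excess_ge[of "min_growth m" "growth m" b w] w(2) b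
      by (simp add: geom_length_subst_pow[OF w(1)])
    then have "min_growth m * ?r + L b * ?gap \<le> ?r * growth (N + m) a"
      using sum_growth_le[OF w(1)] by (rule order_trans)
    ultimately have "?r * (min_growth m + c * ?gap) \<le> ?r * growth (N + m) a"
      by (simp add: algebra_simps)
    then show ?thesis
      by simp
  qed
  then have "min_growth m + c * (max_growth m - min_growth m) \<le> min_growth (N + m)" for m
    unfolding min_growth_def[of "N + m"] by simp
  moreover have "c > 0"
    by (simp add: c_def)
  ultimately show thesis
    using that by blast
qed

theorem growth_converges:
  obtains h where "\<And>a. (\<lambda>m. growth m a) \<longlonglongrightarrow> h" "max_growth \<longlonglongrightarrow> h"
proof -
  have "min_growth m \<le> full_rate" for m
    using order_trans[OF min_growth_le growth_le_full_rate] .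
  then obtain h where h: "min_growth \<longlonglongrightarrow> h"
    using incseq_convergent[OF incseq_min_growth] by blast
  obtain N c where c: "c > 0"
    and increment: "\<And>m. min_growth m + c * (max_growth m - min_growth m) \<le> min_growth (N + m)"
    using min_growth_increment by blast
  have upper: "max_growth m \<le> min_growth m + (min_growth (m + N) - min_growth m) / c" for m
    using increment[of m] c by (simp add: field_simps add.commute)
  have "(\<lambda>m. min_growth m + (min_growth (m + N) - min_growth m) / c) \<longlonglongrightarrow> h + (h - h) / c"
    by (intro tendsto_intros h LIMSEQ_ignore_initial_segment) (use c in auto)
  then have "(\<lambda>m. min_growth m + (min_growth (m + N) - min_growth m) / c) \<longlonglongrightarrow> h"
    by simp
  from tendsto_sandwich[OF _ _ h this] have max: "max_growth \<longlonglongrightarrow> h"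
    using upper min_growth_le_max_growth by simp
  have "(\<lambda>m. growth m a) \<longlonglongrightarrow> h" for a
    by (rule tendsto_sandwich[OF _ _ h max]) simp_all
  with max that show thesis
    by blast
qed

end

section \<open>Legal words\<close>

lemma card_UN_le_mult:
  assumes "finite I" "\<And>i. i \<in> I \<Longrightarrow> real (card (A i)) \<le> b"
  shows "real (card (\<Union>i\<in>I. A i)) \<le> real (card I) * b"
proof -
  have "real (card (\<Union>i\<in>I. A i)) \<le> (\<Sum>i\<in>I. real (card (A i)))"
    using card_UN_le[OF assms(1), of A] by (simp flip: of_nat_sum)
  also have "\<dots> \<le> real (card I) * b"
    using assms(2) by (rule sum_bounded_above)
  finally show ?thesis .
qed

lemma card_sublists_le: "card {w. sublist w v} \<le> (length v + 1)\<^sup>2"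
proof -
  have "card {w. sublist w v} \<le> Suc (length v * Suc (length v) div 2)"
    by (metis card_length length_sublists set_sublists_eq)
  also have "\<dots> \<le> (length v + 1)\<^sup>2"
    by (simp add: power2_eq_square)
  finally show ?thesis .
qed

lemma finite_sublists: "finite {w. sublist w v}"
  by (metis List.finite_set set_sublists_eq)

definition (in letter_lengths) legal_words :: "'a rsubst \<Rightarrow> real \<Rightarrow> 'a list set" where
  "legal_words \<Theta> r = language \<Theta> \<inter> words_upto r"

lemma (in letter_lengths) finite_legal_words [simp]: "finite (legal_words \<Theta> r)"
  by (simp add: legal_words_def)

lemma (in geom_rsubst) card_subst_word_pow_le:
  assumes "lam ^ m * geom_length u \<le> s"
  shows "real (card (subst_word (subst_pow \<Theta> m) u)) \<le> exp (max_growth m * s)"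
proof -
  have "real (card (subst_word (subst_pow \<Theta> m) u)) = exp (lam ^ m * (\<Sum>b\<leftarrow>u. L b * growth m b))"
    unfolding ln_card_subst_word_pow[symmetric] by simp
  also have "\<dots> \<le> exp (lam ^ m * (max_growth m * geom_length u))"
    by (simp add: sum_weighted_le)
  also have "\<dots> \<le> exp (max_growth m * s)"
    using mult_left_mono[OF assms max_growth_nonneg] by (simp add: mult.left_commute)
  finally show ?thesis .
qed

lemma (in geom_rsubst) card_sublists_subst_word_pow_le:
  assumes u: "lam ^ m * geom_length u \<le> s"
  shows "real (card (\<Union>v\<in>subst_word (subst_pow \<Theta> m) u. {w. sublist w v}))
    \<le> exp (max_growth m * s) * (s / Lmin + 1)\<^sup>2"
proof -
  let ?P = "(s / Lmin + 1)\<^sup>2"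
  have "real (card {w. sublist w v}) \<le> ?P" if "v \<in> subst_word (subst_pow \<Theta> m) u" for v
  proof -
    have "geom_length v \<le> s"
      using u unfolding geom_length_subst_word_pow[OF that] .
    then have "(real (length v) + 1)\<^sup>2 \<le> ?P"
      using length_le_geom_length[of v] by (intro power_mono) auto
    moreover have "real (card {w. sublist w v}) \<le> (real (length v) + 1)\<^sup>2"
      using of_nat_mono[OF card_sublists_le[of v], where 'a = real] by (simp add: add.commute)
    ultimately show ?thesis
      by linarith
  qed
  then have "real (card (\<Union>v\<in>subst_word (subst_pow \<Theta> m) u. {w. sublist w v}))
      \<le> real (card (subst_word (subst_pow \<Theta> m) u)) * ?P"
    by (intro card_UN_le_mult) auto
  also have "\<dots> \<le> exp (max_growth m * s) * ?P"
    using card_subst_word_pow_le[OF u] by (intro mult_right_mono) auto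
  finally show ?thesis .
qed

context primitive_geom_rsubst
begin

lemma language_desubstitute:
  assumes "w \<in> language \<Theta>"
  obtains u v where "v \<in> subst_word (subst_pow \<Theta> m) u" "sublist w v"
    "lam ^ m * geom_length u \<le> geom_length w + 2 * (lam ^ m * Lmax)"
proof -
  obtain n a v where v: "v \<in> subst_pow \<Theta> n a" "sublist w v"
    using assms by (auto simp: mem_language_iff)
  obtain N where "\<exists>w\<in>subst_pow \<Theta> (N + m) a. set w = UNIV"
    using primitive_imp_full_words[OF random primitive] by (metis le_add1)
  then obtain u1 u2 where u: "u1 @ a # u2 \<in> subst_pow \<Theta> (N + m) a"
    by (metis UNIV_I split_list)
  obtain v1 v2 where "v1 @ v @ v2 \<in> subst_word (subst_pow \<Theta> n) (u1 @ a # u2)"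
    using subst_word_in_context[OF random_subst_pow v(1)] .
  with u have "v1 @ v @ v2 \<in> subst_pow \<Theta> ((N + m) + n) a"
    by (rule subst_pow_addI)
  also have "(N + m) + n = (N + n) + m"
    by simp
  finally obtain u' where u': "v1 @ v @ v2 \<in> subst_word (subst_pow \<Theta> m) u'"
    by (auto simp: subst_pow_add)
  have w: "sublist w (v1 @ v @ v2)"
    using v(2) by (meson sublist_appendI sublist_order.order_trans)
  have "geom_length y \<le> lam ^ m * Lmax" if "y \<in> subst_pow \<Theta> m b" for y b
    using geom_length_subst_pow[OF that] by (simp add: mult_left_mono)
  then obtain x u'' where x: "x \<in> subst_word (subst_pow \<Theta> m) u''" "sublist w x"
      "geom_length x \<le> geom_length w + 2 * (lam ^ m * Lmax)"
    by (rule subst_word_trim[OF _ _ u' w]) simp_all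
  with that show thesis
    unfolding geom_length_subst_word_pow[OF x(1)] by blast
qed

lemma legal_words_subset:
  assumes "r + 2 * (lam ^ m * Lmax) \<le> s"
  shows "legal_words \<Theta> r
    \<subseteq> (\<Union>u\<in>words_upto (s / lam ^ m). \<Union>v\<in>subst_word (subst_pow \<Theta> m) u. {w. sublist w v})"
proof
  fix w assume "w \<in> legal_words \<Theta> r"
  then have "w \<in> language \<Theta>" and r: "geom_length w \<le> r"
    by (auto simp: legal_words_def)
  from this(1) obtain u v where uv: "v \<in> subst_word (subst_pow \<Theta> m) u" "sublist w v"
    and "lam ^ m * geom_length u \<le> geom_length w + 2 * (lam ^ m * Lmax)"
    by (rule language_desubstitute)
  with r assms have "lam ^ m * geom_length u \<le> s"
    by linarith
  then have "u \<in> words_upto (s / lam ^ m)"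
    by (simp add: field_simps)
  with uv show "w \<in> (\<Union>u\<in>words_upto (s / lam ^ m). \<Union>v\<in>subst_word (subst_pow \<Theta> m) u. {w. sublist w v})"
    by blast
qed

lemma card_legal_words_le:
  fixes m :: nat and r :: real
  assumes "r \<ge> 0"
  defines "s \<equiv> r + 2 * (lam ^ m * Lmax)"
  shows "real (card (legal_words \<Theta> r))
    \<le> exp ((full_rate / lam ^ m + max_growth m) * s) * (s / Lmin + 1)\<^sup>2"
proof -
  let ?U = "words_upto (s / lam ^ m)" and ?P = "(s / Lmin + 1)\<^sup>2"
  let ?F = "\<lambda>u. \<Union>v\<in>subst_word (subst_pow \<Theta> m) u. {w. sublist w v}"
  have "real (card (legal_words \<Theta> r)) \<le> real (card (\<Union>u\<in>?U. ?F u))"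
    using legal_words_subset[of r m s] by (simp add: s_def card_mono finite_sublists)
  also have "\<dots> \<le> real (card ?U) * (exp (max_growth m * s) * ?P)"
    by (intro card_UN_le_mult finite_words_upto card_sublists_subst_word_pow_le)
      (simp add: pos_le_divide_eq mult.commute)
  also have "\<dots> \<le> exp (full_rate * (s / lam ^ m)) * (exp (max_growth m * s) * ?P)"
    using \<open>r \<ge> 0\<close> by (intro mult_right_mono card_words_upto_le) (auto simp: s_def)
  also have "\<dots> = exp ((full_rate / lam ^ m + max_growth m) * s) * ?P"
    by (simp add: distrib_right exp_add)
  finally show ?thesis .
qed

lemma letter_deep_inside_image:
  obtains q u1 u2 where "q \<ge> 1" "u1 @ a # u2 \<in> subst_pow \<Theta> q a" "K \<le> length u1" "K \<le> length u2"
proof -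
  obtain p where p: "real (2 * K) * Lmax / L a < lam ^ p"
    using real_arch_pow[OF lam_gt_1] by blast
  obtain W where W: "W \<in> subst_pow \<Theta> p a"
    using subst_pow_nonempty by blast
  have "Lmax * real (2 * K) < geom_length W"
    using p geom_length_subst_pow[OF W] by (simp add: divide_less_eq mult.commute)
  also have "\<dots> \<le> Lmax * real (length W)"
    by (rule geom_length_le)
  finally have "2 * K < length W"
    by simp
  define W1 c W2 where "W1 = take K W" and "c = W ! K" and "W2 = drop (Suc K) W"
  have split: "W1 @ c # W2 \<in> subst_pow \<Theta> p a" "K \<le> length W1" "K \<le> length W2"
    using W \<open>2 * K < length W\<close> by (auto simp: W1_def c_def W2_def simp flip: id_take_nth_drop)
  obtain N where "\<exists>w\<in>subst_pow \<Theta> (Suc N) c. set w = UNIV"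
    using primitive_imp_full_words[OF random primitive] by (metis le_SucI order_refl)
  then obtain z1 z2 where z: "z1 @ a # z2 \<in> subst_pow \<Theta> (Suc N) c"
    by (metis UNIV_I split_list)
  obtain y1 y2 where y: "y1 @ (z1 @ a # z2) @ y2 \<in> subst_word (subst_pow \<Theta> (Suc N)) (W1 @ c # W2)"
      "length W1 \<le> length y1" "length W2 \<le> length y2"
    using subst_word_in_context[OF random_subst_pow z] .
  have "(y1 @ z1) @ a # (z2 @ y2) \<in> subst_pow \<Theta> (p + Suc N) a"
    using subst_pow_addI[OF split(1) y(1)] by simp
  with y(2,3) split(2,3) show thesis
    by (intro that[of "p + Suc N" "y1 @ z1" "z2 @ y2"]) auto
qed

lemma language_extends:
  assumes v: "v \<in> subst_pow \<Theta> m a"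
  shows "\<exists>u1 u2. length u1 = K \<and> length u2 = K \<and> u1 @ v @ u2 \<in> language \<Theta>"
proof -
  obtain q u1 u2 where u: "q \<ge> 1" "u1 @ a # u2 \<in> subst_pow \<Theta> q a" "K \<le> length u1" "K \<le> length u2"
    using letter_deep_inside_image .
  obtain t1 t2 where t: "t1 @ v @ t2 \<in> subst_word (subst_pow \<Theta> m) (u1 @ a # u2)"
      "length u1 \<le> length t1" "length u2 \<le> length t2"
    using subst_word_in_context[OF random_subst_pow v] .
  let ?v1 = "drop (length t1 - K) t1" and ?v2 = "take K t2"
  have "v \<noteq> []"
    using v by (metis Nil_notin_subst_pow)
  have "t1 @ v @ t2 = take (length t1 - K) t1 @ (?v1 @ v @ ?v2) @ drop K t2"
    by (metis append.assoc append_take_drop_id)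
  then have "sublist (?v1 @ v @ ?v2) (t1 @ v @ t2)"
    by (metis sublist_appendI)
  moreover have "t1 @ v @ t2 \<in> subst_pow \<Theta> (q + m) a"
    using u(2) t(1) by (rule subst_pow_addI)
  ultimately have "?v1 @ v @ ?v2 \<in> language \<Theta>"
    unfolding mem_language_iff using u(1) \<open>v \<noteq> []\<close> by (metis append_is_Nil_conv trans_le_add1)
  then show ?thesis
    using u(3,4) t(2,3) by (intro exI[of _ ?v1] exI[of _ ?v2]) auto
qed

end

section \<open>The subshift\<close>

abbreviation fullshift_top :: "(int \<Rightarrow> 'a) topology" where
  "fullshift_top \<equiv> product_topology (\<lambda>_. discrete_topology UNIV) UNIV"

definition cylinder :: "nat \<Rightarrow> (int \<Rightarrow> 'a) \<Rightarrow> (int \<Rightarrow> 'a) set" where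
  "cylinder n x = {y. \<forall>i. \<bar>i\<bar> \<le> int n \<longrightarrow> y i = x i}"

lemma mem_cylinder_self [simp]: "x \<in> cylinder n x"
  by (simp add: cylinder_def)

lemma cylinder_antimono: "m \<le> n \<Longrightarrow> cylinder n x \<subseteq> cylinder m x"
  by (auto simp: cylinder_def)

lemma cylinder_eq: "y \<in> cylinder n x \<Longrightarrow> cylinder n y = cylinder n x"
  by (auto simp: cylinder_def)

lemma openin_cylinder: "openin fullshift_top (cylinder n x)"
proof -
  let ?S = "\<lambda>i. if \<bar>i\<bar> \<le> int n then {x i} else UNIV"
  have "{i. ?S i \<noteq> UNIV} \<subseteq> {- int n..int n}"
    by auto
  then have "finite {i. ?S i \<noteq> UNIV}"
    by (rule finite_subset) simp
  then have "openin fullshift_top (Pi\<^sub>E UNIV ?S)"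
    unfolding openin_PiE_gen by simp
  moreover have "cylinder n x = Pi\<^sub>E UNIV ?S"
    by (auto simp: cylinder_def PiE_UNIV_domain Pi_iff split: if_splits)
  ultimately show ?thesis
    by simp
qed

lemma fullshift_cylinder_basis:
  assumes "openin fullshift_top W" "x \<in> W"
  shows "\<exists>n. cylinder n x \<subseteq> W"
proof -
  obtain U where U: "finite {i. U i \<noteq> UNIV}" "\<And>i. x i \<in> U i" "Pi\<^sub>E UNIV U \<subseteq> W"
    using assms by (fastforce simp: openin_product_topology_alt PiE_UNIV_domain)
  define n where "n = nat (\<Sum>i\<in>{i. U i \<noteq> UNIV}. \<bar>i\<bar>)"
  have "\<bar>i\<bar> \<le> int n" if "U i \<noteq> UNIV" for i
    unfolding n_def using member_le_sum[of i "{i. U i \<noteq> UNIV}" abs] U(1) that by simp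
  then have "cylinder n x \<subseteq> Pi\<^sub>E UNIV U"
    using U(2) by (force simp: cylinder_def PiE_UNIV_domain)
  with U(3) show ?thesis
    by blast
qed

lemma compact_space_fullshift: "compact_space (fullshift_top :: (int \<Rightarrow> 'a::finite) topology)"
  by (simp add: compact_space_product_topology compact_space_discrete_topology)

lemma openin_window: "openin fullshift_top {x. P (map x [i..j])}"
proof (subst openin_subopen, intro ballI exI conjI)
  fix x assume x: "x \<in> {x. P (map x [i..j])}"
  let ?n = "nat (\<bar>i\<bar> + \<bar>j\<bar>)"
  show "cylinder ?n x \<subseteq> {x. P (map x [i..j])}"
  proof
    fix y assume "y \<in> cylinder ?n x"
    then have "map y [i..j] = map x [i..j]"
      by (auto simp: cylinder_def)
    with x show "y \<in> {x. P (map x [i..j])}"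
      by (simp only: mem_Collect_eq)
  qed
qed (simp_all add: openin_cylinder)

lemma closedin_window: "closedin fullshift_top {x. P (map x [i..j])}"
proof -
  have "topspace fullshift_top - {x. P (map x [i..j])} = {x. \<not> P (map x [i..j])}"
    by auto
  then show ?thesis
    unfolding closedin_def using openin_window[of "\<lambda>w. \<not> P w"] by simp
qed

lemma topspace_X_top [simp]: "topspace (X_top \<Theta>) = subshift \<Theta>"
  by (simp add: X_top_def)

lemma compact_space_X_top: "compact_space (X_top (\<Theta> :: ('a::finite) rsubst))"
proof -
  have "subshift \<Theta> = (\<Inter>(i, j)\<in>{(i, j). i \<le> j}. {x. map x [i..j] \<in> language \<Theta>})"
    by (auto simp: subshift_def)
  also have "closedin fullshift_top \<dots>"
    by (intro closedin_INT) (auto intro: closedin_window)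
  finally show ?thesis
    unfolding X_top_def
    by (intro compact_space_subtopology closedin_compact_space[OF compact_space_fullshift])
qed

lemma map_upto_split:
  assumes "i \<le> i'" "i' \<le> j'" "j' \<le> j"
  shows "map x [i..j] = map x [i..i' - 1] @ map x [i'..j'] @ map x [j' + 1..j]"
  using assms by (simp add: upto_split1[of i i' j] upto_split2[of i' j' j] flip: map_append)

lemma sublist_map_upto:
  assumes "i \<le> i'" "i' \<le> j'" "j' \<le> j"
  shows "sublist (map x [i'..j']) (map x [i..j])"
  unfolding map_upto_split[OF assms] by (rule sublist_appendI)

lemma exists_sequence_with_window:
  "\<exists>x. map x [- int (length u1)..int (length v + length u2) - 1] = u1 @ v @ u2
    \<and> map x [0..int (length v) - 1] = v"
  by (intro exI[of _ "\<lambda>i. (u1 @ v @ u2) ! nat (i + int (length u1))"] conjI; rule nth_equalityI)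
    (auto simp: nth_upto nth_append nat_add_distrib)

definition legal_extensions :: "'a rsubst \<Rightarrow> 'a list \<Rightarrow> nat \<Rightarrow> (int \<Rightarrow> 'a) set" where
  "legal_extensions \<Theta> v K = {x. map x [0..int (length v) - 1] = v}
    \<inter> {x. map x [- int K..int (length v + K) - 1] \<in> language \<Theta>}"

lemma closedin_legal_extensions: "closedin fullshift_top (legal_extensions \<Theta> v K)"
  unfolding legal_extensions_def by (intro closedin_Int closedin_window)

lemma legal_extensions_window:
  assumes "x \<in> legal_extensions \<Theta> v K" "- int K \<le> i" "i \<le> j" "j \<le> int (length v + K) - 1"
  shows "map x [i..j] \<in> language \<Theta>"
  using assms sublist_map_upto[of "- int K" i j "int (length v + K) - 1" x]
  by (auto simp: legal_extensions_def intro: language_sublist)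

lemma antimono_legal_extensions:
  assumes "v \<noteq> []"
  shows "antimono (legal_extensions \<Theta> v)"
proof (intro antimonoI subsetI)
  fix K K' x assume "K \<le> K'" and x: "x \<in> legal_extensions \<Theta> v K'"
  have "0 < int (length v)"
    using assms by simp
  then have "map x [- int K..int (length v + K) - 1] \<in> language \<Theta>"
    by (intro legal_extensions_window[OF x]) (use \<open>K \<le> K'\<close> in linarith)+
  with x show "x \<in> legal_extensions \<Theta> v K"
    by (simp add: legal_extensions_def)
qed

lemma subshift_point_exists:
  fixes \<Theta> :: "('a::finite) rsubst"
  assumes "v \<noteq> []"
    and extends: "\<And>K. \<exists>u1 u2. length u1 = K \<and> length u2 = K \<and> u1 @ v @ u2 \<in> language \<Theta>"
  shows "\<exists>x\<in>subshift \<Theta>. map x [0..int (length v) - 1] = v"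
proof -
  have "\<Inter>(range (legal_extensions \<Theta> v)) \<noteq> {}"
  proof (rule compact_space_imp_nest[OF compact_space_fullshift])
    show "legal_extensions \<Theta> v K \<noteq> {}" for K
    proof -
      obtain u1 u2 where "length u1 = K" "length u2 = K" "u1 @ v @ u2 \<in> language \<Theta>"
        using extends by blast
      then show ?thesis
        using exists_sequence_with_window[of u1 v u2] by (force simp: legal_extensions_def)
    qed
  qed (simp_all add: closedin_legal_extensions antimono_legal_extensions[OF \<open>v \<noteq> []\<close>])
  then obtain x where x: "\<And>K. x \<in> legal_extensions \<Theta> v K"
    by blast
  have "0 < int (length v)"
    using \<open>v \<noteq> []\<close> by simp
  then have "map x [i..j] \<in> language \<Theta>" if "i \<le> j" for i j
    using that by (intro legal_extensions_window[OF x[of "nat (\<bar>i\<bar> + \<bar>j\<bar>)"]]) linarith+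
  with x[of 0] show ?thesis
    by (auto simp: legal_extensions_def subshift_def)
qed

lemma continuous_map_coordinate: "continuous_map (X_top \<Theta>) (discrete_topology UNIV) (\<lambda>x. x i)"
  unfolding X_top_def
  by (intro continuous_map_from_subtopology continuous_map_product_projection) simp

definition shift_by :: "int \<Rightarrow> (int \<Rightarrow> 'a) \<Rightarrow> int \<Rightarrow> 'a" where
  "shift_by n x = (\<lambda>i. x (i + n))"

lemma shift_by_apply [simp]: "shift_by n x i = x (i + n)"
  by (simp add: shift_by_def)

lemma shift_by_shift_by [simp]: "shift_by m (shift_by n x) = shift_by (m + n) x"
  by (auto simp: shift_by_def add.assoc)

lemma shift_by_0 [simp]: "shift_by 0 x = x"
  by (simp add: shift_by_def)

lemma shift_eq_shift_by: "shift x = shift_by 1 x"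
  by (simp add: shift_by_def shift_def)

lemma map_shift_by: "map (shift_by n x) [i..j] = map x [i + n..j + n]"
  by (rule nth_equalityI) (auto simp: nth_upto algebra_simps)

lemma shift_by_in_subshift [simp]: "x \<in> subshift \<Theta> \<Longrightarrow> shift_by n x \<in> subshift \<Theta>"
  by (simp add: subshift_def map_shift_by)

lemma continuous_map_shift_by: "continuous_map (X_top \<Theta>) (X_top \<Theta>) (shift_by n)"
proof -
  have "continuous_map (X_top \<Theta>) fullshift_top (shift_by n)"
    by (simp add: continuous_map_componentwise_UNIV continuous_map_coordinate)
  then have "continuous_map (X_top \<Theta>) (subtopology fullshift_top (subshift \<Theta>)) (shift_by n)"
    by (rule continuous_map_into_subtopology) simp
  then show ?thesis
    unfolding X_top_def .
qed

section \<open>The strip over the subshift\<close>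

abbreviation strip_top :: "'a rsubst \<Rightarrow> ((int \<Rightarrow> 'a) \<times> real) topology" where
  "strip_top \<Theta> \<equiv> prod_topology (X_top \<Theta>) euclideanreal"

definition strip_box :: "'a rsubst \<Rightarrow> nat \<Rightarrow> (int \<Rightarrow> 'a) \<times> real \<Rightarrow> ((int \<Rightarrow> 'a) \<times> real) set" where
  "strip_box \<Theta> n p = (subshift \<Theta> \<inter> cylinder n (fst p)) \<times> ball (snd p) ((1 / 2) ^ n)"

lemma mem_strip_box_iff:
  "q \<in> strip_box \<Theta> n p \<longleftrightarrow>
    fst q \<in> subshift \<Theta> \<and> fst q \<in> cylinder n (fst p) \<and> \<bar>snd q - snd p\<bar> < (1 / 2) ^ n"
  by (cases q) (auto simp: strip_box_def dist_real_def abs_minus_commute)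

lemma mem_strip_box_self: "fst p \<in> subshift \<Theta> \<Longrightarrow> p \<in> strip_box \<Theta> n p"
  by (simp add: mem_strip_box_iff)

lemma openin_strip_box: "openin (strip_top \<Theta>) (strip_box \<Theta> n p)"
proof -
  have "openin (X_top \<Theta>) (subshift \<Theta> \<inter> cylinder n (fst p))"
    unfolding X_top_def by (intro openin_subtopology_Int2 openin_cylinder)
  moreover have "openin euclideanreal (ball (snd p) ((1 / 2) ^ n))"
    by (simp flip: open_openin)
  ultimately show ?thesis
    unfolding strip_box_def openin_prod_Times_iff by blast
qed

lemma strip_box_antimono: "m \<le> n \<Longrightarrow> strip_box \<Theta> n p \<subseteq> strip_box \<Theta> m p"
  unfolding strip_box_def
  by (intro Sigma_mono Int_mono cylinder_antimono subset_ball power_decreasing) auto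

lemma strip_box_triangle:
  assumes "q \<in> strip_box \<Theta> (Suc n) p" "r \<in> strip_box \<Theta> (Suc n) q"
  shows "r \<in> strip_box \<Theta> n p"
proof -
  have "fst r \<in> cylinder (Suc n) (fst p)"
    using assms cylinder_eq[of "fst q" "Suc n" "fst p"] by (simp add: mem_strip_box_iff)
  moreover have "\<bar>snd q - snd p\<bar> < (1 / 2) ^ Suc n" "\<bar>snd r - snd q\<bar> < (1 / 2) ^ Suc n"
    using assms by (simp_all only: mem_strip_box_iff)
  then have "\<bar>snd r - snd p\<bar> < (1 / 2) ^ n"
    using abs_triangle_ineq[of "snd r - snd q" "snd q - snd p"] by simp
  ultimately show ?thesis
    using assms(2) cylinder_antimono[of n "Suc n" "fst p"] by (auto simp: mem_strip_box_iff)
qed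

lemma strip_box_basis:
  assumes "openin (strip_top \<Theta>) W" "p \<in> W"
  shows "\<exists>n. strip_box \<Theta> n p \<subseteq> W"
proof -
  obtain U V where U: "openin (X_top \<Theta>) U" "fst p \<in> U" and V: "open V" "snd p \<in> V" and "U \<times> V \<subseteq> W"
    using assms unfolding openin_prod_topology_alt open_openin[symmetric] by (metis prod.collapse)
  obtain U' where U': "openin fullshift_top U'" "U = U' \<inter> subshift \<Theta>"
    using U(1) unfolding X_top_def openin_subtopology by blast
  obtain k where k: "cylinder k (fst p) \<subseteq> U'"
    using fullshift_cylinder_basis[OF U'(1)] U(2) U'(2) by blast
  obtain \<delta> where \<delta>: "\<delta> > 0" "ball (snd p) \<delta> \<subseteq> V"
    using V open_contains_ball by blast
  obtain m :: nat where m: "(1 / 2) ^ m < \<delta>"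
    using real_arch_pow_inv[OF \<delta>(1), of "1 / 2"] by auto
  have "strip_box \<Theta> (max k m) p \<subseteq> strip_box \<Theta> k p \<inter> strip_box \<Theta> m p"
    using strip_box_antimono[of k "max k m" \<Theta> p] strip_box_antimono[of m "max k m" \<Theta> p] by auto
  also have "\<dots> \<subseteq> U \<times> V"
    using k \<delta>(2) m U'(2) by (auto simp: strip_box_def)
  finally show ?thesis
    using \<open>U \<times> V \<subseteq> W\<close> by blast
qed

section \<open>The suspension as a quotient of the strip\<close>

lemma roof_sum_0 [simp]: "roof_sum L 0 x = 0"
  by (simp add: roof_sum_def)

lemma roof_sum_Suc: "roof_sum L (n + 1) x = roof_sum L n x + L (x n)"
proof (cases "n \<ge> 0")
  case True
  then have "{0..<n + 1} = insert n {0..<n}"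
    by auto
  with True show ?thesis
    by (simp add: roof_sum_def)
next
  case False
  then have "{n..<0} = insert n {n + 1..<0}"
    by auto
  with False show ?thesis
    by (cases "n = -1") (auto simp: roof_sum_def)
qed

lemma roof_sum_add: "roof_sum L (m + n) x = roof_sum L n x + roof_sum L m (shift_by n x)"
proof (induction m rule: int_induct[where k = 0])
  case (step1 i)
  have "roof_sum L (i + 1 + n) x = roof_sum L (i + n) x + L (x (i + n))"
    using roof_sum_Suc[of L "i + n" x] by (simp add: ac_simps)
  moreover have "roof_sum L (i + 1) (shift_by n x) = roof_sum L i (shift_by n x) + L (x (i + n))"
    unfolding roof_sum_Suc by simp
  ultimately show ?case
    using step1 by linarith
next
  case (step2 i)
  have "roof_sum L (i + n) x = roof_sum L (i - 1 + n) x + L (x (i - 1 + n))"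
    using roof_sum_Suc[of L "i - 1 + n" x] by (simp add: ac_simps)
  moreover have "roof_sum L i (shift_by n x) = roof_sum L (i - 1) (shift_by n x) + L (x (i - 1 + n))"
    using roof_sum_Suc[of L "i - 1" "shift_by n x"] by simp
  ultimately show ?case
    using step2 by linarith
qed simp

lemma roof_sum_cylinder: "y \<in> cylinder k x \<Longrightarrow> \<bar>n\<bar> \<le> int k \<Longrightarrow> roof_sum L n y = roof_sum L n x"
  by (auto simp: roof_sum_def cylinder_def intro!: sum.cong arg_cong[where f = L])

definition recenter :: "('a \<Rightarrow> real) \<Rightarrow> int \<Rightarrow> (int \<Rightarrow> 'a) \<times> real \<Rightarrow> (int \<Rightarrow> 'a) \<times> real" where
  "recenter L n p = (shift_by n (fst p), snd p - roof_sum L n (fst p))"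

lemma fst_recenter [simp]: "fst (recenter L n p) = shift_by n (fst p)"
  and snd_recenter [simp]: "snd (recenter L n p) = snd p - roof_sum L n (fst p)"
  by (simp_all add: recenter_def)

lemma recenter_recenter [simp]: "recenter L m (recenter L n p) = recenter L (m + n) p"
  by (simp add: recenter_def roof_sum_add)

lemma recenter_0 [simp]: "recenter L 0 p = p"
  by (simp add: recenter_def)

lemma istopology_quotient:
  "istopology (\<lambda>U. U \<subseteq> S \<and> openin T {x \<in> D. f x \<in> U})"
  unfolding istopology_def
proof (intro conjI allI impI; (elim conjE)?)
  fix A B assume "A \<subseteq> S" "B \<subseteq> S" and "openin T {x \<in> D. f x \<in> A}" "openin T {x \<in> D. f x \<in> B}"
  moreover have "{x \<in> D. f x \<in> A \<inter> B} = {x \<in> D. f x \<in> A} \<inter> {x \<in> D. f x \<in> B}"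
    by blast
  ultimately show "A \<inter> B \<subseteq> S" "openin T {x \<in> D. f x \<in> A \<inter> B}"
    by auto
next
  fix \<K> assume \<K>: "\<forall>K\<in>\<K>. K \<subseteq> S \<and> openin T {x \<in> D. f x \<in> K}"
  then show "\<Union>\<K> \<subseteq> S"
    by blast
  have "{x \<in> D. f x \<in> \<Union>\<K>} = (\<Union>K\<in>\<K>. {x \<in> D. f x \<in> K})"
    by blast
  with \<K> show "openin T {x \<in> D. f x \<in> \<Union>\<K>}"
    by (auto intro!: openin_Union)
qed

locale suspension = letter_lengths L for L :: "'a::finite \<Rightarrow> real" +
  fixes \<Theta> :: "'a rsubst"
begin

abbreviation roof :: "int \<Rightarrow> (int \<Rightarrow> 'a) \<Rightarrow> real" where "roof \<equiv> roof_sum L"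
abbreviation X :: "(int \<Rightarrow> 'a) set" where "X \<equiv> subshift \<Theta>"
abbreviation strip :: "((int \<Rightarrow> 'a) \<times> real) topology" where "strip \<equiv> strip_top \<Theta>"
abbreviation Y :: "((int \<Rightarrow> 'a) \<times> real) topology" where "Y \<equiv> Y_top \<Theta> L"

abbreviation time_one :: "(int \<Rightarrow> 'a) \<times> real \<Rightarrow> (int \<Rightarrow> 'a) \<times> real" where
  "time_one \<equiv> susp_flow \<Theta> L 1"

lemma roof_diff_bounds:
  assumes "m \<le> n"
  shows "Lmin * real_of_int (n - m) \<le> roof n x - roof m x \<and>
    roof n x - roof m x \<le> Lmax * real_of_int (n - m)"
  using assms
proof (induction n rule: int_ge_induct)
  case (step i)
  have factor: "c * real_of_int (i + 1 - m) = c * real_of_int (i - m) + c" for c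
    by (simp add: algebra_simps)
  show ?case
    unfolding roof_sum_Suc factor using step.IH Lmin_le[of "x i"] L_le_Lmax[of "x i"]
    by (intro conjI; linarith)
qed simp

lemmas roof_diff_ge = roof_diff_bounds[THEN conjunct1]
  and roof_diff_le = roof_diff_bounds[THEN conjunct2]

lemma roof_mono: "m \<le> n \<Longrightarrow> roof m x \<le> roof n x"
  using order_trans[OF mult_nonneg_nonneg roof_diff_ge[of m n x]] by simp

lemma roof_nonneg: "0 \<le> n \<Longrightarrow> 0 \<le> roof n x"
  using roof_mono[of 0 n x] by simp

lemma abs_roof_diff_ge: "Lmin * \<bar>real_of_int (n - m)\<bar> \<le> \<bar>roof n x - roof m x\<bar>"
proof (induction m n rule: linorder_wlog)
  case (le m n)
  then show ?case
    using roof_diff_ge[of m n x] by simp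
next
  case (sym m n)
  then show ?case
    by (simp add: abs_minus_commute)
qed

lemma roof_index_exists: "\<exists>n. roof n x \<le> s \<and> s < roof (n + 1) x"
proof -
  obtain N :: nat where N: "\<bar>s\<bar> < real N * Lmin"
    using ex_less_of_nat_mult[OF Lmin_pos] by blast
  let ?above = "\<lambda>k. s < roof (int k - int N) x"
  have "?above (2 * N)" "\<not> ?above 0"
    using roof_diff_ge[of 0 "int N" x] roof_diff_ge[of "- int N" 0 x] N
    by (auto simp: mult.commute)
  then obtain k where "\<not> ?above k" "?above (Suc k)"
    using ex_least_nat_less[of ?above "2 * N"] by blast
  then show ?thesis
    by (intro exI[of _ "int k - int N"]) (simp add: algebra_simps)
qed

lemma roof_index_unique:
  assumes "roof m x \<le> s" "s < roof (m + 1) x" "roof n x \<le> s" "s < roof (n + 1) x"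
  shows "m = n"
proof (rule ccontr)
  assume "m \<noteq> n"
  then consider "m + 1 \<le> n" | "n + 1 \<le> m"
    by linarith
  then show False
    using assms roof_mono[of "m + 1" n x] roof_mono[of "n + 1" m x] by cases auto
qed

definition tile_index :: "(int \<Rightarrow> 'a) \<times> real \<Rightarrow> int" where
  "tile_index p = (THE n. roof n (fst p) \<le> snd p \<and> snd p < roof (n + 1) (fst p))"

lemma roof_tile_index_le: "roof (tile_index p) (fst p) \<le> snd p"
  and less_roof_tile_index: "snd p < roof (tile_index p + 1) (fst p)"
proof -
  have "\<exists>!n. roof n (fst p) \<le> snd p \<and> snd p < roof (n + 1) (fst p)"
    using roof_index_exists roof_index_unique by (metis (no_types, lifting))
  from theI'[OF this]
  show "roof (tile_index p) (fst p) \<le> snd p" "snd p < roof (tile_index p + 1) (fst p)"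
    by (auto simp: tile_index_def)
qed

lemma tile_index_nonneg: "0 \<le> snd p \<Longrightarrow> 0 \<le> tile_index p"
  using less_roof_tile_index[of p] roof_mono[of "tile_index p + 1" 0 "fst p"] by fastforce

lemma tile_index_mono: "s \<le> t \<Longrightarrow> tile_index (x, s) \<le> tile_index (x, t)"
  using roof_tile_index_le[of "(x, s)"] less_roof_tile_index[of "(x, t)"]
    roof_mono[of "tile_index (x, t) + 1" "tile_index (x, s)" x] by fastforce

text \<open>\<open>hull_point\<close> sends \<open>(x, s)\<close> to the canonical representative of \<open>T\<^sub>s (x, 0)\<close>. Its fibres are the
  orbits of the \<open>\<int>\<close>-action \<open>recenter\<close>, which is how the strip \<open>X \<times> \<real>\<close> covers the hull.\<close>

definition hull_point :: "(int \<Rightarrow> 'a) \<times> real \<Rightarrow> (int \<Rightarrow> 'a) \<times> real" where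
  "hull_point p = recenter L (tile_index p) p"

lemma snd_hull_point_bounds:
  "0 \<le> snd (hull_point p)" "snd (hull_point p) < L (fst (hull_point p) 0)"
  using roof_tile_index_le[of p] less_roof_tile_index[of p]
  by (simp_all add: hull_point_def roof_sum_Suc)

lemma hull_point_eqI:
  assumes "q = recenter L n p" "0 \<le> snd q" "snd q < L (fst q 0)"
  shows "hull_point p = q"
proof -
  have "tile_index p = n"
    using assms roof_tile_index_le[of p] less_roof_tile_index[of p]
    by (intro roof_index_unique[of _ "fst p" "snd p"]) (auto simp: roof_sum_Suc)
  then show ?thesis
    by (simp add: hull_point_def assms(1))
qed

lemma hull_point_recenter [simp]: "hull_point (recenter L n p) = hull_point p"
proof (rule hull_point_eqI)
  show "hull_point p = recenter L (tile_index p - n) (recenter L n p)"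
    by (simp add: hull_point_def)
qed (rule snd_hull_point_bounds)+

lemma hull_point_eqE:
  assumes "hull_point p = hull_point q"
  obtains n where "q = recenter L n p"
proof
  have "recenter L (- tile_index q) (hull_point p) = recenter L (- tile_index q) (hull_point q)"
    by (simp only: assms)
  then show "q = recenter L (tile_index p - tile_index q) p"
    by (simp add: hull_point_def)
qed

lemma susp_reps_subset: "susp_reps \<Theta> L \<subseteq> X \<times> {0..Lmax}"
  using order_trans[OF less_imp_le L_le_Lmax] by (auto simp: susp_reps_def)

lemma hull_point_in_reps: "fst p \<in> X \<Longrightarrow> hull_point p \<in> susp_reps \<Theta> L"
  using snd_hull_point_bounds[of p]
  by (cases "hull_point p") (auto simp: susp_reps_def hull_point_def recenter_def)

lemma hull_point_of_rep: "p \<in> susp_reps \<Theta> L \<Longrightarrow> hull_point p = p"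
  by (rule hull_point_eqI[of _ 0]) (auto simp: susp_reps_def)

lemma susp_quot_eq_hull_point:
  assumes "p \<in> susp_domain \<Theta> L"
  shows "susp_quot L p = hull_point p"
proof (cases "snd p = L (fst p 0)")
  case True
  then have "hull_point p = recenter L 1 p"
    using roof_sum_Suc[of L 0 "fst p"] by (intro hull_point_eqI[of _ 1]) auto
  with True show ?thesis
    using roof_sum_Suc[of L 0 "fst p"] by (simp add: susp_quot_def recenter_def shift_eq_shift_by)
next
  case False
  with assms have "p \<in> susp_reps \<Theta> L"
    by (auto simp: susp_domain_def susp_reps_def)
  with False show ?thesis
    by (simp add: susp_quot_def hull_point_of_rep)
qed

lemma susp_flow_hull_point:
  assumes "fst p \<in> X"
  shows "susp_flow \<Theta> L t (hull_point p) = hull_point (fst p, snd p + t)"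
proof -
  let ?p = "(fst p, snd p + t)"
  have rep: "hull_point ?p \<in> susp_reps \<Theta> L"
    using assms by (intro hull_point_in_reps) simp
  have orbit: "fst q = (\<lambda>i. fst (hull_point p) (i + n)) \<and>
      snd q = snd (hull_point p) + t - roof n (fst (hull_point p))
      \<longleftrightarrow> q = recenter L (n + tile_index p) ?p" for q n
    by (cases q) (auto simp: hull_point_def recenter_def shift_by_def roof_sum_add add.assoc)
  show ?thesis
    unfolding susp_flow_def orbit
  proof (rule the_equality)
    show "hull_point ?p \<in> susp_reps \<Theta> L \<and> (\<exists>n. hull_point ?p = recenter L (n + tile_index p) ?p)"
      using rep by (auto simp: hull_point_def intro!: exI[of _ "tile_index ?p - tile_index p"])
  next
    fix q assume "q \<in> susp_reps \<Theta> L \<and> (\<exists>n. q = recenter L (n + tile_index p) ?p)"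
    then show "q = hull_point ?p"
      by (metis hull_point_of_rep hull_point_recenter)
  qed
qed

lemma funpow_time_one_hull_point:
  assumes "x \<in> X"
  shows "(time_one ^^ i) (hull_point (x, s)) = hull_point (x, s + real i)"
  by (induction i) (use assms susp_flow_hull_point in \<open>auto simp: algebra_simps\<close>)

lemma continuous_map_letter_length: "continuous_map (X_top \<Theta>) euclideanreal (\<lambda>x. L (x i))"
  using continuous_map_compose[OF continuous_map_coordinate[of \<Theta> i], of euclideanreal L]
  by (simp add: o_def)

lemma continuous_map_roof: "continuous_map (X_top \<Theta>) euclideanreal (roof n)"
  unfolding roof_sum_def
  by (cases "n \<ge> 0")
    (simp_all add: continuous_map_sum continuous_map_minus continuous_map_letter_length)

lemma continuous_map_recenter: "continuous_map strip strip (recenter L n)"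
proof -
  have "continuous_map strip (X_top \<Theta>) (\<lambda>p. shift_by n (fst p))"
    using continuous_map_compose[OF continuous_map_fst continuous_map_shift_by] by (simp add: o_def)
  moreover have "continuous_map strip euclideanreal (\<lambda>p. roof n (fst p))"
    using continuous_map_compose[OF continuous_map_fst continuous_map_roof] by (simp add: o_def)
  ultimately show ?thesis
    unfolding recenter_def by (intro continuous_map_pairedI continuous_map_diff continuous_map_snd)
qed

lemma openin_Y_top:
  "openin Y U \<longleftrightarrow> U \<subseteq> susp_reps \<Theta> L \<and>
    openin (susp_domain_top \<Theta> L) {p \<in> susp_domain \<Theta> L. susp_quot L p \<in> U}"
  unfolding Y_top_def by (simp add: topology_inverse'[OF istopology_quotient])

lemma susp_domain_subset: "susp_domain \<Theta> L \<subseteq> X \<times> UNIV"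
  by (auto simp: susp_domain_def)

lemma topspace_susp_domain_top: "topspace (susp_domain_top \<Theta> L) = susp_domain \<Theta> L"
  unfolding susp_domain_top_def using susp_domain_subset by auto

lemma topspace_Y_top: "topspace Y = susp_reps \<Theta> L"
proof
  have "susp_quot L p \<in> susp_reps \<Theta> L" if "p \<in> susp_domain \<Theta> L" for p
    using that susp_domain_subset hull_point_in_reps by (auto simp: susp_quot_eq_hull_point)
  then have "{p \<in> susp_domain \<Theta> L. susp_quot L p \<in> susp_reps \<Theta> L} = topspace (susp_domain_top \<Theta> L)"
    by (auto simp: topspace_susp_domain_top)
  then have "openin Y (susp_reps \<Theta> L)"
    by (simp add: openin_Y_top)
  then show "susp_reps \<Theta> L \<subseteq> topspace Y"
    by (rule openin_subset)
  show "topspace Y \<subseteq> susp_reps \<Theta> L"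
    using openin_topspace[of Y] unfolding openin_Y_top by blast
qed

lemma continuous_map_susp_quot: "continuous_map (susp_domain_top \<Theta> L) Y (susp_quot L)"
  unfolding continuous_map_def topspace_susp_domain_top topspace_Y_top
proof (intro conjI allI impI)
  show "susp_quot L \<in> susp_domain \<Theta> L \<rightarrow> susp_reps \<Theta> L"
    using susp_domain_subset hull_point_in_reps by (auto simp: susp_quot_eq_hull_point)
qed (simp add: openin_Y_top)

lemma closedin_susp_domain: "closedin strip (susp_domain \<Theta> L)"
proof -
  have roof: "continuous_map strip euclideanreal (\<lambda>p. L (fst p 0))"
    using continuous_map_compose[OF continuous_map_fst continuous_map_letter_length]
    by (simp add: o_def)
  have "susp_domain \<Theta> L =
      {p \<in> topspace strip. snd p \<in> {0..}} \<inter> {p \<in> topspace strip. L (fst p 0) - snd p \<in> {0..}}"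
    by (auto simp: susp_domain_def)
  also have "closedin strip \<dots>"
    by (intro closedin_Int closedin_continuous_map_preimage[where Y = euclideanreal]
        continuous_map_diff continuous_map_snd roof) (simp_all flip: closed_closedin)
  finally show ?thesis .
qed

definition tile_strip :: "int \<Rightarrow> ((int \<Rightarrow> 'a) \<times> real) set" where
  "tile_strip n = {p \<in> topspace strip. recenter L n p \<in> susp_domain \<Theta> L}"

lemma mem_tile_strip_tile_index: "p \<in> topspace strip \<Longrightarrow> p \<in> tile_strip (tile_index p)"
  using roof_tile_index_le[of p] less_roof_tile_index[of p]
  by (auto simp: tile_strip_def susp_domain_def recenter_def roof_sum_Suc)

lemma closedin_tile_strip: "closedin strip (tile_strip n)"
  unfolding tile_strip_def
  by (rule closedin_continuous_map_preimage[OF continuous_map_recenter closedin_susp_domain])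

lemma locally_finite_tile_strips:
  assumes "p \<in> topspace strip"
  shows "\<exists>V. openin strip V \<and> p \<in> V \<and> finite {n. tile_strip n \<inter> V \<noteq> {}}"
proof (intro exI conjI)
  let ?c = "(\<bar>snd p\<bar> + 1 + Lmax) / Lmin"
  show "openin strip (strip_box \<Theta> 0 p)" "p \<in> strip_box \<Theta> 0 p"
    using assms by (auto simp: openin_strip_box intro: mem_strip_box_self)
  have "\<bar>n\<bar> \<le> \<lceil>?c\<rceil>" if q: "q \<in> tile_strip n" "q \<in> strip_box \<Theta> 0 p" for n q
  proof -
    have "0 \<le> snd q - roof n (fst q)" "snd q - roof n (fst q) \<le> L (fst q n)"
      using q(1) by (auto simp: tile_strip_def susp_domain_def recenter_def)
    moreover have "\<bar>snd q - snd p\<bar> < 1"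
      using q(2) by (simp add: mem_strip_box_iff)
    ultimately have "\<bar>roof n (fst q)\<bar> \<le> \<bar>snd p\<bar> + 1 + Lmax"
      using L_le_Lmax[of "fst q n"] by linarith
    then have "Lmin * \<bar>real_of_int n\<bar> \<le> \<bar>snd p\<bar> + 1 + Lmax"
      using abs_roof_diff_ge[of n 0 "fst q"] by simp
    then have "real_of_int \<bar>n\<bar> \<le> ?c"
      by (simp add: pos_le_divide_eq mult.commute)
    then show ?thesis
      by linarith
  qed
  then have "{n. tile_strip n \<inter> strip_box \<Theta> 0 p \<noteq> {}} \<subseteq> {- \<lceil>?c\<rceil>..\<lceil>?c\<rceil>}"
    by force
  then show "finite {n. tile_strip n \<inter> strip_box \<Theta> 0 p \<noteq> {}}"
    by (rule finite_subset) simp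
qed

lemma continuous_map_hull_point: "continuous_map strip Y hull_point"
proof (rule pasting_lemma_locally_finite[where I = UNIV and T = tile_strip])
  let ?f = "\<lambda>n. susp_quot L \<circ> recenter L n"
  show "continuous_map (subtopology strip (tile_strip n)) Y (?f n)" for n
  proof (rule continuous_map_compose[OF _ continuous_map_susp_quot])
    show "continuous_map (subtopology strip (tile_strip n)) (susp_domain_top \<Theta> L) (recenter L n)"
      unfolding susp_domain_top_def
      by (intro continuous_map_into_subtopology continuous_map_from_subtopology
          continuous_map_recenter) (auto simp: tile_strip_def)
  qed
  have quot: "?f n p = hull_point p" if "p \<in> tile_strip n" for n p
    using that by (simp add: tile_strip_def susp_quot_eq_hull_point)
  then show "?f m p = ?f n p" if "p \<in> topspace strip \<inter> tile_strip m \<inter> tile_strip n" for m n p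
    using that by auto
  show "\<exists>n. n \<in> UNIV \<and> p \<in> tile_strip n \<and> hull_point p = ?f n p" if "p \<in> topspace strip" for p
    using mem_tile_strip_tile_index[OF that] quot by (metis UNIV_I)
qed (simp_all add: closedin_tile_strip locally_finite_tile_strips)

lemma hull_point_image_fundamental_domain: "hull_point ` (X \<times> {0..Lmax}) = topspace Y"
proof (intro equalityI subsetI)
  fix p assume "p \<in> topspace Y"
  then have p: "p \<in> susp_reps \<Theta> L"
    by (simp add: topspace_Y_top)
  then have "p \<in> X \<times> {0..Lmax}"
    using susp_reps_subset by blast
  with p show "p \<in> hull_point ` (X \<times> {0..Lmax})"
    by (intro image_eqI[of _ _ p]) (simp_all add: hull_point_of_rep)
qed (auto simp: topspace_Y_top hull_point_in_reps)

theorem quotient_map_hull_point: "quotient_map strip Y hull_point"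
  unfolding quotient_map_def
proof (intro conjI allI impI iffI)
  show "hull_point ` topspace strip = topspace Y"
  proof
    show "hull_point ` topspace strip \<subseteq> topspace Y"
      by (auto simp: topspace_Y_top hull_point_in_reps)
    show "topspace Y \<subseteq> hull_point ` topspace strip"
      unfolding hull_point_image_fundamental_domain[symmetric] by auto
  qed
next
  fix U assume "U \<subseteq> topspace Y" and U: "openin strip {p \<in> topspace strip. hull_point p \<in> U}"
  have "{p \<in> susp_domain \<Theta> L. susp_quot L p \<in> U}
      = {p \<in> topspace strip. hull_point p \<in> U} \<inter> susp_domain \<Theta> L"
    using susp_domain_subset by (auto simp: susp_quot_eq_hull_point)
  with U have "openin (susp_domain_top \<Theta> L) {p \<in> susp_domain \<Theta> L. susp_quot L p \<in> U}"
    by (auto simp: susp_domain_top_def openin_subtopology)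
  with \<open>U \<subseteq> topspace Y\<close> show "openin Y U"
    by (simp add: openin_Y_top topspace_Y_top)
next
  fix U assume "openin Y U"
  with continuous_map_hull_point show "openin strip {p \<in> topspace strip. hull_point p \<in> U}"
    by (rule openin_continuous_map_preimage)
qed

lemma open_map_hull_point: "open_map strip Y hull_point"
  unfolding open_map_def
proof (intro allI impI)
  fix W assume W: "openin strip W"
  have "hull_point ` W \<subseteq> topspace Y"
    using openin_subset[OF W] hull_point_in_reps by (auto simp: topspace_Y_top)
  moreover have "{p \<in> topspace strip. hull_point p \<in> hull_point ` W}
      = (\<Union>n. {p \<in> topspace strip. recenter L n p \<in> W})"
    by (auto elim!: hull_point_eqE) (metis hull_point_recenter image_eqI)
  then have "openin strip {p \<in> topspace strip. hull_point p \<in> hull_point ` W}"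
    using openin_continuous_map_preimage[OF continuous_map_recenter W] by auto
  ultimately show "openin Y (hull_point ` W)"
    using quotient_map_hull_point by (simp add: quotient_map_def)
qed

lemma compactin_fundamental_domain: "compactin strip (X \<times> {0..Lmax})"
proof -
  have "compactin (X_top \<Theta>) X"
    using compact_space_X_top[of \<Theta>] by (simp add: compact_space_def)
  then show ?thesis
    by (simp add: compactin_Times)
qed

lemma compact_space_Y_top: "compact_space Y"
  using image_compactin[OF compactin_fundamental_domain continuous_map_hull_point]
  by (simp add: compact_space_def hull_point_image_fundamental_domain)

lemma susp_flow_maps:
  assumes "y \<in> topspace Y"
  shows "susp_flow \<Theta> L t y \<in> topspace Y"
proof -
  have "y \<in> susp_reps \<Theta> L" "fst y \<in> X"
    using assms by (auto simp: topspace_Y_top susp_reps_def)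
  then show ?thesis
    using susp_flow_hull_point[of y t]
    by (simp add: hull_point_of_rep topspace_Y_top hull_point_in_reps)
qed

section \<open>Open covers of the hull and legal words\<close>

lemma cover_systemI:
  assumes "X \<noteq> {}" "open_cover Y U"
  shows "cover_system Y time_one U"
proof
  show "topspace Y \<noteq> {}"
    using assms(1) hull_point_in_reps[of "(x, 0)" for x] by (fastforce simp: topspace_Y_top)
  show "has_finite_subcover Y U"
    by (rule compact_space_imp_has_finite_subcover[OF compact_space_Y_top assms(2)])
qed (rule susp_flow_maps)

lemma geom_length_window: "i \<le> j \<Longrightarrow> geom_length (map x [i..j - 1]) = roof j x - roof i x"
proof (induction j rule: int_ge_induct)
  case (step j)
  then have "[i..j] = [i..j - 1] @ [j]"
    by (simp add: upto_rec2)
  with step show ?case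
    by (simp add: roof_sum_Suc)
qed simp

lemma letter_of_window:
  assumes "map x [0..int (length w) - 1] = w" "j < length w"
  shows "x (int j) = w ! j"
  using arg_cong[OF assms(1), of "\<lambda>w. w ! j"] assms(2) by simp

lemma roof_less_geom_length:
  assumes "map x [0..int (length w) - 1] = w" "j < length w"
  shows "roof (int j) x < geom_length w"
proof -
  have "roof (int j) x < roof (int j + 1) x"
    by (simp add: roof_sum_Suc)
  also have "\<dots> \<le> roof (int (length w)) x"
    using assms(2) by (intro roof_mono) simp
  also have "\<dots> = geom_length w"
    using geom_length_window[of 0 "int (length w)" x] assms(1) by simp
  finally show ?thesis .
qed

lemma hull_cover_lebesgue_number:
  assumes "open_cover Y U"
  shows "\<exists>k. \<forall>p\<in>X \<times> {0..Lmax}. \<exists>A\<in>U. hull_point ` strip_box \<Theta> k p \<subseteq> A"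
proof -
  define pullback where "pullback A = {p \<in> topspace strip. hull_point p \<in> A}" for A
  have open_pullback: "openin strip (pullback A)" if "A \<in> U" for A
    unfolding pullback_def using that assms
    by (intro openin_continuous_map_preimage[OF continuous_map_hull_point]) (simp add: open_cover_def)
  have "\<exists>k. \<forall>p\<in>X \<times> {0..Lmax}. \<exists>W\<in>pullback ` U. strip_box \<Theta> k p \<subseteq> W"
  proof (rule lebesgue_number_basis[OF compactin_fundamental_domain])
    show "openin strip W" if "W \<in> pullback ` U" for W
      using that open_pullback by blast
    have "hull_point p \<in> \<Union>U" if "p \<in> X \<times> {0..Lmax}" for p
      using that assms hull_point_in_reps[of p] by (auto simp: open_cover_def topspace_Y_top)
    then show "X \<times> {0..Lmax} \<subseteq> \<Union>(pullback ` U)"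
      by (fastforce simp: pullback_def)
  qed (auto simp: openin_strip_box mem_strip_box_self
      intro: strip_box_basis strip_box_triangle subsetD[OF strip_box_antimono])
  then obtain k where k: "\<And>p. p \<in> X \<times> {0..Lmax} \<Longrightarrow> \<exists>A\<in>U. strip_box \<Theta> k p \<subseteq> pullback A"
    by blast
  have "\<exists>A\<in>U. hull_point ` strip_box \<Theta> k p \<subseteq> A" if "p \<in> X \<times> {0..Lmax}" for p
    using k[OF that] unfolding pullback_def by blast
  then show ?thesis
    by blast
qed

definition window_nbhd :: "nat \<Rightarrow> (int \<Rightarrow> 'a) \<times> real \<Rightarrow> ((int \<Rightarrow> 'a) \<times> real) set" where
  "window_nbhd k p = {q \<in> X \<times> UNIV.
    (\<forall>i\<in>{- int k..tile_index p + int k}. fst q i = fst p i) \<and> \<bar>snd q - snd p\<bar> < (1 / 2) ^ k}"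

lemma recenter_window_nbhd:
  assumes "0 \<le> snd p" "q \<in> window_nbhd k p"
  shows "recenter L (tile_index p) q \<in> strip_box \<Theta> k (recenter L (tile_index p) p)"
proof -
  let ?n = "tile_index p"
  have n: "?n \<ge> 0"
    using assms(1) by (rule tile_index_nonneg)
  have same: "fst q i = fst p i" if "- int k \<le> i" "i \<le> ?n + int k" for i
    using assms(2) that by (auto simp: window_nbhd_def)
  have "roof ?n (fst q) = roof ?n (fst p)"
    using n by (auto simp: roof_sum_def same intro!: sum.cong)
  moreover have "shift_by ?n (fst q) \<in> cylinder k (shift_by ?n (fst p))"
    using n by (auto simp: cylinder_def intro!: same)
  ultimately show ?thesis
    using assms(2) by (auto simp: mem_strip_box_iff window_nbhd_def)
qed

lemma hull_cover_window_nbhd: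
  assumes "open_cover Y U"
  shows "\<exists>k. \<forall>p\<in>X \<times> {0..}. \<exists>A\<in>U. hull_point ` window_nbhd k p \<subseteq> A"
proof -
  obtain k where k: "\<And>p. p \<in> X \<times> {0..Lmax} \<Longrightarrow> \<exists>A\<in>U. hull_point ` strip_box \<Theta> k p \<subseteq> A"
    using hull_cover_lebesgue_number[OF assms] by blast
  have "\<exists>A\<in>U. hull_point ` window_nbhd k p \<subseteq> A" if p: "p \<in> X \<times> {0..}" for p
  proof -
    let ?r = "recenter L (tile_index p)"
    have "?r p \<in> X \<times> {0..Lmax}"
      using hull_point_in_reps[of p] p susp_reps_subset by (auto simp: hull_point_def)
    from k[OF this] obtain A where A: "A \<in> U" "hull_point ` strip_box \<Theta> k (?r p) \<subseteq> A"
      by blast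
    have "hull_point q \<in> A" if "q \<in> window_nbhd k p" for q
    proof -
      have "?r q \<in> strip_box \<Theta> k (?r p)"
        using p that by (auto intro: recenter_window_nbhd)
      then have "hull_point (?r q) \<in> A"
        using A(2) by blast
      then show ?thesis
        by simp
    qed
    with A(1) show ?thesis
      by blast
  qed
  then show ?thesis
    by blast
qed

text \<open>Up to time \<open>n\<close> the orbit of \<open>p\<close> crosses only tiles that start before \<open>n + Lmax\<close>; the code
  records these tiles with a margin of \<open>k\<close> tiles, and the height of \<open>p\<close> up to \<open>(1 / 2) ^ k\<close>.\<close>

definition orbit_code :: "nat \<Rightarrow> nat \<Rightarrow> (int \<Rightarrow> 'a) \<times> real \<Rightarrow> 'a list \<times> int" where
  "orbit_code k n p =
    (map (fst p) [- int k..tile_index (fst p, real n + Lmax) + int k], \<lfloor>snd p * 2 ^ k\<rfloor>)"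

lemma orbit_code_mem:
  assumes "p \<in> topspace Y"
  shows "orbit_code k n p \<in> legal_words \<Theta> (real n + Lmax * (2 * real k + 2)) \<times> {0..\<lfloor>Lmax * 2 ^ k\<rfloor>}"
proof -
  obtain x s where p: "p = (x, s)" and x: "x \<in> X" and s: "0 \<le> s" "s \<le> Lmax"
    using assms susp_reps_subset by (cases p) (auto simp: topspace_Y_top)
  define J where "J = tile_index (x, real n + Lmax)"
  have "J \<ge> 0"
    using tile_index_nonneg[of "(x, real n + Lmax)"] by (simp add: J_def)
  let ?w = "map x [- int k..J + int k]"
  have "geom_length ?w = roof (J + int k + 1) x - roof (- int k) x"
    using geom_length_window[of "- int k" "J + int k + 1" x] \<open>J \<ge> 0\<close> by simp
  moreover have "roof (J + int k + 1) x - roof J x \<le> Lmax * (real k + 1)"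
    using roof_diff_le[of J "J + int k + 1" x] by simp
  moreover have "roof 0 x - roof (- int k) x \<le> Lmax * real k"
    using roof_diff_le[of "- int k" 0 x] by simp
  moreover have "roof J x \<le> real n + Lmax"
    using roof_tile_index_le[of "(x, real n + Lmax)"] by (simp add: J_def)
  ultimately have "geom_length ?w \<le> real n + Lmax * (2 * real k + 2)"
    by (simp add: algebra_simps)
  moreover have "?w \<in> language \<Theta>"
    using x \<open>J \<ge> 0\<close> by (simp add: subshift_def)
  moreover have "\<lfloor>s * 2 ^ k\<rfloor> \<in> {0..\<lfloor>Lmax * 2 ^ k\<rfloor>}"
    using s by (auto intro!: floor_mono mult_right_mono)
  ultimately show ?thesis
    by (simp add: orbit_code_def p J_def legal_words_def)
qed

lemma orbit_code_eq_imp_window_nbhd: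
  assumes code: "orbit_code k n q = orbit_code k n p"
    and mem: "p \<in> topspace Y" "q \<in> topspace Y" and "i < n"
  shows "(fst q, snd q + real i) \<in> window_nbhd k (fst p, snd p + real i)"
proof -
  let ?J = "\<lambda>p. tile_index (fst p, real n + Lmax)"
  have words: "map (fst q) [- int k..?J q + int k] = map (fst p) [- int k..?J p + int k]"
    and heights: "\<lfloor>snd q * 2 ^ k\<rfloor> = \<lfloor>snd p * 2 ^ k\<rfloor>"
    using code by (auto simp: orbit_code_def)
  have "?J q = ?J p"
    using arg_cong[OF words, of length] tile_index_nonneg[of "(fst p, real n + Lmax)"]
      tile_index_nonneg[of "(fst q, real n + Lmax)"] by simp
  with words have letters: "fst q l = fst p l" if "l \<in> {- int k..?J p + int k}" for l
    using that by auto
  have "\<bar>snd q * 2 ^ k - snd p * 2 ^ k\<bar> < 1"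
    using heights by linarith
  then have "\<bar>snd q - snd p\<bar> * 2 ^ k < 1"
    by (simp add: abs_mult flip: left_diff_distrib)
  then have "\<bar>snd q - snd p\<bar> < (1 / 2) ^ k"
    by (simp add: power_one_over pos_less_divide_eq)
  moreover have "snd p \<le> Lmax" and "fst q \<in> X"
    using mem susp_reps_subset by (auto simp: topspace_Y_top)
  moreover have "tile_index (fst p, snd p + real i) \<le> ?J p"
    using \<open>snd p \<le> Lmax\<close> \<open>i < n\<close> by (intro tile_index_mono) simp
  ultimately show ?thesis
    using letters by (auto simp: window_nbhd_def)
qed

lemma orbit_code_cell_subset:
  assumes k: "\<And>p. p \<in> X \<times> {0..} \<Longrightarrow> \<exists>A\<in>U. hull_point ` window_nbhd k p \<subseteq> A"
    and p: "p \<in> topspace Y"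
  shows "\<exists>B\<in>join_cover Y time_one n U.
    \<forall>q\<in>topspace Y. orbit_code k n q = orbit_code k n p \<longrightarrow> q \<in> B"
proof -
  let ?at = "\<lambda>p i. (fst p, snd p + real i)"
  have flow: "(time_one ^^ i) q = hull_point (?at q i)" if "q \<in> topspace Y" for q i
    using that funpow_time_one_hull_point[of "fst q" i "snd q"] susp_reps_subset
      hull_point_of_rep[of q] by (auto simp: topspace_Y_top)
  have "\<exists>A\<in>U. hull_point ` window_nbhd k (?at p i) \<subseteq> A" for i
    by (rule k) (use p susp_reps_subset in \<open>auto simp: topspace_Y_top\<close>)
  then obtain A where A: "\<And>i. A i \<in> U" "\<And>i. hull_point ` window_nbhd k (?at p i) \<subseteq> A i"
    by metis
  have "(time_one ^^ i) q \<in> A i"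
    if "q \<in> topspace Y" "orbit_code k n q = orbit_code k n p" "i < n" for q i
    using A(2)[of i] orbit_code_eq_imp_window_nbhd[OF that(2) p that(1,3)] flow[OF that(1)] by auto
  moreover have "{y \<in> topspace Y. \<forall>i<n. (time_one ^^ i) y \<in> A i} \<in> join_cover Y time_one n U"
    unfolding mem_join_cover_iff using A(1) by (intro exI[of _ A]) simp
  ultimately show ?thesis
    by (intro bexI) auto
qed

lemma min_subcover_join_le_legal_words:
  assumes "open_cover Y U"
  obtains C D where "C \<ge> 0" "D > 0"
    "\<And>n. min_subcover Y (join_cover Y time_one n U) \<le> card (legal_words \<Theta> (real n + C)) * D"
proof -
  obtain k where k: "\<And>p. p \<in> X \<times> {0..} \<Longrightarrow> \<exists>A\<in>U. hull_point ` window_nbhd k p \<subseteq> A"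
    using hull_cover_window_nbhd[OF assms] by blast
  define C where "C = Lmax * (2 * real k + 2)"
  define heights where "heights = {0..\<lfloor>Lmax * 2 ^ k\<rfloor>}"
  show thesis
  proof (rule that[of C "card heights"])
    fix n
    have "min_subcover Y (join_cover Y time_one n U) \<le> card (legal_words \<Theta> (real n + C) \<times> heights)"
    proof (rule min_subcover_le_card_codes[OF _ _ _ orbit_code_cell_subset[OF k]])
      show "orbit_code k n ` topspace Y \<subseteq> legal_words \<Theta> (real n + C) \<times> heights"
        unfolding C_def heights_def using orbit_code_mem by blast
    qed (auto simp: heights_def mem_join_cover_iff)
    then show "min_subcover Y (join_cover Y time_one n U)
        \<le> card (legal_words \<Theta> (real n + C)) * card heights"
      by (simp add: card_cartesian_product)
  qed (simp_all add: C_def heights_def)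
qed

section \<open>Covers by small patches\<close>

definition patch_cover :: "nat \<Rightarrow> ((int \<Rightarrow> 'a) \<times> real) set set" where
  "patch_cover k = (\<lambda>p. hull_point ` strip_box \<Theta> k p) ` (X \<times> {0..Lmax})"

lemma open_cover_patch_cover: "open_cover Y (patch_cover k)"
proof -
  have "openin Y A" if "A \<in> patch_cover k" for A
    using that unfolding patch_cover_def
    by (auto intro!: open_map_hull_point[unfolded open_map_def, rule_format] openin_strip_box)
  moreover have "topspace Y \<subseteq> \<Union>(patch_cover k)"
    unfolding hull_point_image_fundamental_domain[symmetric]
    by (force simp: patch_cover_def intro: mem_strip_box_self)
  ultimately show ?thesis
    unfolding open_cover_def using openin_subset by blast
qed

text \<open>The radius of a resolving patch is at most half a tile, so the boundary between two tiles
  cannot be confused with another one, and such a patch sees one unit of time into the future.\<close>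

definition resolving :: "nat \<Rightarrow> bool" where
  "resolving k \<longleftrightarrow> (1 / 2) ^ k \<le> Lmin / 2 \<and> (1 + Lmax + Lmin / 2) / Lmin \<le> real k"

lemma resolving_exists: "\<exists>k. resolving k"
proof -
  obtain m where m: "(1 / 2) ^ m < Lmin / 2"
    using real_arch_pow_inv[of "Lmin / 2" "1 / 2"] by auto
  obtain n where n: "(1 + Lmax + Lmin / 2) / Lmin \<le> real n"
    using real_arch_simple by blast
  have "(1 / 2) ^ max m n \<le> ((1 / 2) ^ m :: real)"
    by (intro power_decreasing) auto
  moreover have "real n \<le> real (max m n)"
    by simp
  ultimately have "resolving (max m n)"
    unfolding resolving_def using m n by (intro conjI; linarith)
  then show ?thesis ..
qed

lemma roof_within_half_tile_unique:
  assumes "\<bar>roof q x - c\<bar> < Lmin / 2" "\<bar>roof q' x - c\<bar> < Lmin / 2"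
  shows "q = q'"
proof -
  have "Lmin * \<bar>real_of_int (q - q')\<bar> \<le> \<bar>roof q x - roof q' x\<bar>"
    by (rule abs_roof_diff_ge)
  also have "\<dots> < Lmin"
    using assms by linarith
  finally show ?thesis
    by simp
qed

lemma resolving_patch_boundary:
  assumes "resolving k" and s: "0 \<le> s" "s \<le> Lmax"
    and patch: "hull_point (y, t) \<in> hull_point ` strip_box \<Theta> k (z, s)"
    and soon: "t \<le> roof j y" "roof j y \<le> t + 1"
  shows "\<exists>q. \<bar>roof q z - (roof j y - t + s)\<bar> < Lmin / 2 \<and> y j = z q"
proof -
  obtain p where p: "recenter L p (y, t) \<in> strip_box \<Theta> k (z, s)"
    using patch by (auto elim: hull_point_eqE)
  then have cyl: "shift_by p y \<in> cylinder k z" and "\<bar>t - roof p y - s\<bar> < (1 / 2) ^ k"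
    by (auto simp: mem_strip_box_iff)
  then have close: "\<bar>t - roof p y - s\<bar> < Lmin / 2"
    using \<open>resolving k\<close> by (simp add: resolving_def)
  define q where "q = j - p"
  have shifted: "roof q (shift_by p y) = roof j y - roof p y"
    using roof_sum_add[of L q p y] by (simp add: q_def)
  have "Lmin * \<bar>real_of_int q\<bar> \<le> \<bar>roof j y - roof p y\<bar>"
    using abs_roof_diff_ge[of q 0 "shift_by p y"] shifted by simp
  also have "\<dots> \<le> 1 + Lmax + Lmin / 2"
    using close s soon by linarith
  finally have "\<bar>real_of_int q\<bar> \<le> (1 + Lmax + Lmin / 2) / Lmin"
    by (simp add: pos_le_divide_eq mult.commute)
  then have q: "\<bar>q\<bar> \<le> int k"
    using \<open>resolving k\<close> unfolding resolving_def by linarith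
  then have "roof q z = roof j y - roof p y"
    using roof_sum_cylinder[OF cyl q] shifted by simp
  then have "\<bar>roof q z - (roof j y - t + s)\<bar> < Lmin / 2"
    using close by linarith
  moreover have "y j = z q"
    using cyl q by (auto simp: cylinder_def q_def)
  ultimately show ?thesis
    by blast
qed

lemma resolving_patch_determines_letter:
  assumes "resolving k" and patch: "A \<in> patch_cover k" "hull_point (x, t) \<in> A" "hull_point (x', t) \<in> A"
    and same: "roof j x' = roof j x" and soon: "t \<le> roof j x" "roof j x \<le> t + 1"
  shows "x j = x' j"
proof -
  obtain z s where A: "A = hull_point ` strip_box \<Theta> k (z, s)" "0 \<le> s" "s \<le> Lmax"
    using patch(1) by (auto simp: patch_cover_def)
  obtain q where q: "\<bar>roof q z - (roof j x - t + s)\<bar> < Lmin / 2" "x j = z q"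
    using resolving_patch_boundary[OF \<open>resolving k\<close> A(2,3), of x t z j] patch(2) soon A(1) by auto
  obtain q' where q': "\<bar>roof q' z - (roof j x - t + s)\<bar> < Lmin / 2" "x' j = z q'"
    using resolving_patch_boundary[OF \<open>resolving k\<close> A(2,3), of x' t z j] patch(3) same soon A(1)
    by auto
  show ?thesis
    using roof_within_half_tile_unique[OF q(1) q'(1)] q(2) q'(2) by simp
qed

lemma resolving_itinerary_determines_letters:
  assumes "resolving k" and B: "B \<in> join_cover Y time_one n (patch_cover k)"
      "hull_point (x, 0) \<in> B" "hull_point (x', 0) \<in> B"
    and x: "x \<in> X" "x' \<in> X" and early: "roof (int j) x < real n"
  shows "x (int j) = x' (int j)"
  using early
proof (induction j rule: less_induct)
  case (less j)
  have same: "x l = x' l" if "0 \<le> l" "l < int j" for l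
    using less.IH[of "nat l"] that less.prems roof_mono[of l "int j" x] by simp
  define r where "r = roof (int j) x"
  have r': "roof (int j) x' = r"
    unfolding r_def roof_sum_def using same by (auto intro!: sum.cong)
  have r: "0 \<le> r" "r < real n"
    using less.prems by (simp_all add: r_def roof_nonneg)
  define i where "i = nat \<lfloor>r\<rfloor>"
  have i: "real i \<le> r" "r \<le> real i + 1" "i < n"
    using r unfolding i_def by linarith+
  obtain A where A: "B = {y \<in> topspace Y. \<forall>i<n. (time_one ^^ i) y \<in> A i}"
      "\<forall>i<n. A i \<in> patch_cover k"
    using B(1) unfolding mem_join_cover_iff by (elim exE conjE)
  have "hull_point (x, real i) \<in> A i" "hull_point (x', real i) \<in> A i"
    using B(2,3) A(1) i(3) funpow_time_one_hull_point[OF x(1), of i 0]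
      funpow_time_one_hull_point[OF x(2), of i 0] by auto
  then show ?case
    using A(2) i r'
    by (intro resolving_patch_determines_letter[OF \<open>resolving k\<close>]) (auto simp: r_def)
qed

end

section \<open>Entropy of the hull\<close>

sublocale geom_rsubst \<subseteq> suspension L \<Theta> ..

context primitive_geom_rsubst
begin

lemma subshift_contains_subst_pow:
  assumes "v \<in> subst_pow \<Theta> m a"
  shows "\<exists>x\<in>X. map x [0..int (length v) - 1] = v"
proof (rule subshift_point_exists)
  show "v \<noteq> []"
    using assms by (metis Nil_notin_subst_pow)
qed (rule language_extends[OF assms])

lemma subshift_nonempty: "X \<noteq> {}"
  using subshift_contains_subst_pow[of "[undefined]" 0 undefined] by auto

lemma cover_system_time_one: "open_cover Y U \<Longrightarrow> cover_system Y time_one U"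
  by (rule cover_systemI[OF subshift_nonempty])

lemma card_subst_pow_le_min_subcover:
  assumes "resolving k" and n: "lam ^ m * L a \<le> real n"
  shows "card (subst_pow \<Theta> m a) \<le> min_subcover Y (join_cover Y time_one n (patch_cover k))"
proof -
  interpret cover_system Y time_one "patch_cover k"
    by (rule cover_system_time_one[OF open_cover_patch_cover])
  obtain x where x: "\<And>v. v \<in> subst_pow \<Theta> m a \<Longrightarrow> x v \<in> X"
      and window: "\<And>v. v \<in> subst_pow \<Theta> m a \<Longrightarrow> map (x v) [0..int (length v) - 1] = v"
    using subshift_contains_subst_pow by metis
  let ?f = "\<lambda>v. hull_point (x v, 0)"
  show ?thesis
  proof (rule card_separated_le_min_subcover[OF has_finite_subcover_join, where f = ?f])
    show "?f ` subst_pow \<Theta> m a \<subseteq> topspace Y"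
      using x by (auto simp: topspace_Y_top hull_point_in_reps)
  next
    fix B v w
    assume B: "B \<in> join_cover Y time_one n (patch_cover k)" "?f v \<in> B" "?f w \<in> B"
      and v: "v \<in> subst_pow \<Theta> m a" and w: "w \<in> subst_pow \<Theta> m a"
    show "v = w"
    proof (rule geom_length_eq_imp_eq)
      show "geom_length v = geom_length w"
        using v w by (simp add: geom_length_subst_pow)
    next
      fix j assume j: "j < length v" "j < length w"
      have "roof (int j) (x v) < real n"
        using roof_less_geom_length[OF window[OF v] j(1)] geom_length_subst_pow[OF v] n by simp
      then have "x v (int j) = x w (int j)"
        by (rule resolving_itinerary_determines_letters[OF \<open>resolving k\<close> B x[OF v] x[OF w]])
      then show "v ! j = w ! j"
        using letter_of_window[OF window[OF v] j(1)] letter_of_window[OF window[OF w] j(2)] by simp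
    qed
  qed
qed

lemma growth_limit_le_cover_entropy:
  assumes "resolving k" and h: "(\<lambda>m. growth m a) \<longlonglongrightarrow> h"
  shows "h \<le> cover_entropy Y time_one (patch_cover k)"
proof -
  interpret cover_system Y time_one "patch_cover k"
    by (rule cover_system_time_one[OF open_cover_patch_cover])
  show ?thesis
  proof (rule cover_entropy_geI)
    show "filterlim (\<lambda>m. lam ^ m * L a) at_top sequentially"
      using lam_gt_1 L_pos[of a] by real_asymp
    show "(\<lambda>m. ln (real (card (subst_pow \<Theta> m a))) / (lam ^ m * L a)) \<longlonglongrightarrow> h"
      using h unfolding growth_def .
    show "ln (real (card (subst_pow \<Theta> m a))) \<le> ln (real (join_number n))"
      if "lam ^ m * L a \<le> real n" for m n
      using card_subst_pow_le_min_subcover[OF \<open>resolving k\<close> that] by (intro ln_mono) auto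
  qed
qed

lemma cover_entropy_le_max_growth:
  assumes "open_cover Y U"
  shows "cover_entropy Y time_one U \<le> full_rate / lam ^ m + max_growth m" (is "_ \<le> ?h")
proof -
  interpret cover_system Y time_one U
    by (rule cover_system_time_one[OF assms])
  obtain C D where "C \<ge> 0" "D > 0"
    and le: "\<And>n. join_number n \<le> card (legal_words \<Theta> (real n + C)) * D"
    using min_subcover_join_le_legal_words[OF assms] by blast
  define e where "e = C + 2 * (lam ^ m * Lmax)"
  have "e > 0"
    using \<open>C \<ge> 0\<close> by (simp add: e_def add_nonneg_pos)
  show ?thesis
  proof (rule cover_entropy_leI)
    fix n
    have "real (join_number n) \<le> real (card (legal_words \<Theta> (real n + C))) * real D"
      using of_nat_mono[OF le[of n], where 'a = real] by simp
    also have "\<dots> \<le> exp (?h * (real n + e)) * ((real n + e) / Lmin + 1)\<^sup>2 * real D"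
      using card_legal_words_le[of "real n + C" m] \<open>C \<ge> 0\<close>
      by (intro mult_right_mono) (simp_all add: e_def add.assoc)
    finally have "ln (real (join_number n))
        \<le> ln (exp (?h * (real n + e)) * ((real n + e) / Lmin + 1)\<^sup>2 * real D)"
      using join_number_pos[of n] by (intro ln_mono) auto
    also have "\<dots> = ?h * (real n + e) + 2 * ln ((real n + e) / Lmin + 1) + ln (real D)"
    proof -
      have "(real n + e) / Lmin + 1 > 0"
        using \<open>e > 0\<close> by (simp add: add_nonneg_pos)
      then show ?thesis
        using \<open>D > 0\<close> by (simp add: ln_mult ln_realpow)
    qed
    finally show "ln (real (join_number n))
        \<le> ?h * (real n + e) + 2 * ln ((real n + e) / Lmin + 1) + ln (real D)" .
  qed (rule affine_plus_ln_over_n_tendsto[OF Lmin_pos \<open>e > 0\<close>])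
qed

theorem hull_entropy_eq_growth_limit:
  assumes h: "\<And>a. (\<lambda>m. growth m a) \<longlonglongrightarrow> h" "max_growth \<longlonglongrightarrow> h"
  shows "hull_entropy \<Theta> L = ereal h"
proof (rule antisym)
  show "hull_entropy \<Theta> L \<le> ereal h"
    unfolding hull_entropy_def top_entropy_def
  proof (rule SUP_least)
    fix U assume "U \<in> {U. open_cover Y U}"
    then have U: "open_cover Y U"
      by simp
    have "(\<lambda>m. full_rate / lam ^ m) \<longlonglongrightarrow> 0"
      using tendsto_mult[OF tendsto_const LIMSEQ_inverse_realpow_zero[OF lam_gt_1]]
      by (simp add: divide_inverse)
    from tendsto_add[OF this h(2)] have "cover_entropy Y time_one U \<le> 0 + h"
      by (rule LIMSEQ_le_const) (use cover_entropy_le_max_growth[OF U] in blast)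
    then show "ereal (cover_entropy Y time_one U) \<le> ereal h"
      by simp
  qed
  obtain k where "resolving k"
    using resolving_exists by blast
  then show "ereal h \<le> hull_entropy \<Theta> L"
    unfolding hull_entropy_def top_entropy_def
    using open_cover_patch_cover growth_limit_le_cover_entropy[OF _ h(1)]
    by (intro SUP_upper2[of "patch_cover k"]) simp_all
qed

end

theorem theoremA:
  fixes \<Theta> :: "('a::finite) rsubst" and lam :: real and L :: "'a \<Rightarrow> real"
  assumes "random_subst \<Theta>"
    and "primitive_rsubst \<Theta>"
    and "geom_compatible_data \<Theta> lam L"
  shows "\<forall>a. \<exists>h. (\<lambda>m. ln (real (card (subst_pow \<Theta> m a))) / (lam ^ m * L a)) \<longlonglongrightarrow> h
              \<and> ereal h = hull_entropy \<Theta> L"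
proof -
  interpret primitive_geom_rsubst \<Theta> lam L
    by unfold_locales (rule assms)+
  obtain h where h: "\<And>a. (\<lambda>m. growth m a) \<longlonglongrightarrow> h" "max_growth \<longlonglongrightarrow> h"
    using growth_converges by blast
  then have "hull_entropy \<Theta> L = ereal h"
    by (rule hull_entropy_eq_growth_limit)
  with h(1) show ?thesis
    unfolding growth_def by metis
qed

end
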